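(* Let $X$ be a nonsingular real algebraic variety and let $Y$ be a nonsingular real subvariety of $X$. Then both $\mathbb{C}Y$ and $\mathbb{R}X$ are smooth submanifolds of $\mathbb{C}X$, and $\mathbb{R}Y=\mathbb{C}Y\cap\mathbb{R}X$. Moreover, $\mathbb{C}Y$ and $\mathbb{R}X$ are not transverse in $\mathbb{C}X$ unless $\mathbb{R}Y\cap\mathbb{R}X=\varnothing$ or $\dim Y=\dim X$.
   Context: A real algebraic variety $X$ consists of the set $\mathbb{C}X$ of its complex points (a complex algebraic variety), an anti-holomorphic involution $\mathrm{conj}:\mathbb{C}X\to\mathbb{C}X$, and the set $\mathbb{R}X=\mathrm{Fix}(\mathrm{conj})$ of real points. A real subvariety $Y\subset X$ is given by a complex algebraic subvariety $\mathbb{C}Y\subset\mathbb{C}X$ invariant under $\mathrm{conj}$, with the restricted involution. If $X$ is nonsingular, $\mathbb{C}X$ is a complex manifold (hence also a smooth manifold), $\mathrm{conj}$ is a diffeomorphism and $\mathbb{R}X$ is a smooth submanifold of $\mathbb{C}X$. Manifolds have constant dimension, i.e. the nonsingular varieties $X$, $Y$ are equidimensional, and $\dim X$, $\dim Y$ denote their dimensions (equal to $\dim_{\mathbb C}\mathbb{C}X$, $\dim_{\mathbb C}\mathbb{C}Y$). Two smooth submanifolds $V,W$ of a smooth manifold $U$ are transverse if $T_pV+T_pW=T_pU$ for every $p\in V\cap W$. *)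

theory Defs
  imports "HOL-Analysis.Analysis"
begin

section \<open>Complex algebraic varieties\<close>

text \<open>
  Varieties are reduced and given by a finite affine atlas (Serre's definition). All affine pieces
  lie in one affine space \<open>\<complex>\<^sup>N\<close> with \<open>N = CARD('n)\<close>; this is no restriction, because the atlas is
  finite and affine spaces embed in larger ones. Varieties need not be irreducible or complete.
\<close>

inductive polyfun :: "(complex ^ 'n \<Rightarrow> complex) \<Rightarrow> bool" where
  const: "polyfun (\<lambda>x. c)"
| coord: "polyfun (\<lambda>x. x $ i)"
| add: "polyfun f \<Longrightarrow> polyfun g \<Longrightarrow> polyfun (\<lambda>x. f x + g x)"
| mult: "polyfun f \<Longrightarrow> polyfun g \<Longrightarrow> polyfun (\<lambda>x. f x * g x)"

definition zariski_closed :: "(complex ^ 'n) set \<Rightarrow> bool" where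
  "zariski_closed V \<longleftrightarrow>
     (\<exists>F. finite F \<and> (\<forall>f\<in>F. polyfun f) \<and> V = {x. \<forall>f\<in>F. f x = 0})"

definition regular_on :: "(complex ^ 'n) set \<Rightarrow> (complex ^ 'n \<Rightarrow> complex) \<Rightarrow> bool" where
  "regular_on S f \<longleftrightarrow>
     (\<forall>p\<in>S. \<exists>g h. polyfun g \<and> polyfun h \<and> h p \<noteq> 0 \<and> (\<forall>x\<in>S. h x \<noteq> 0 \<longrightarrow> f x = g x / h x))"

definition join :: "complex ^ 'n \<Rightarrow> complex ^ 'm \<Rightarrow> complex ^ ('n + 'm)" where
  "join x y = (\<chi> k. case k of Inl i \<Rightarrow> x $ i | Inr j \<Rightarrow> y $ j)"

text \<open>
  An element \<open>(U, \<phi>)\<close> of the atlas is an affine open set with its embedding in affine space; the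
  values of \<open>\<phi>\<close> outside \<open>U\<close> are irrelevant.
\<close>

record ('a, 'n::finite) variety =
  points :: "'a set"
  atlas :: "('a set \<times> ('a \<Rightarrow> complex ^ 'n)) set"

text \<open>The last conjunct is separatedness: the diagonal is closed in each product of charts.\<close>

definition algebraic_variety :: "('a, 'n::finite, 'z) variety_scheme \<Rightarrow> bool" where
  "algebraic_variety X \<longleftrightarrow>
     finite (atlas X) \<and>
     points X = (\<Union>(U, \<phi>)\<in>atlas X. U) \<and>
     (\<forall>(U, \<phi>)\<in>atlas X. inj_on \<phi> U \<and> zariski_closed (\<phi> ` U)) \<and>
     (\<forall>(U, \<phi>)\<in>atlas X. \<forall>(V, \<psi>)\<in>atlas X.
        (\<exists>Z. zariski_closed Z \<and> \<phi> ` (U \<inter> V) = \<phi> ` U - Z) \<and>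
        (\<forall>j. regular_on (\<phi> ` (U \<inter> V)) (\<lambda>z. \<psi> (inv_into U \<phi> z) $ j)) \<and>
        zariski_closed ((\<lambda>x. join (\<phi> x) (\<psi> x)) ` (U \<inter> V)))"

definition closed_subvariety :: "('a, 'n::finite, 'z) variety_scheme \<Rightarrow> 'a set \<Rightarrow> bool" where
  "closed_subvariety X Z \<longleftrightarrow>
     Z \<subseteq> points X \<and> (\<forall>(U, \<phi>)\<in>atlas X. zariski_closed (\<phi> ` (Z \<inter> U)))"

text \<open>Subvarieties are locally closed; \<open>Z' = {}\<close> gives the closed ones.\<close>

definition subvariety :: "('a, 'n::finite, 'z) variety_scheme \<Rightarrow> 'a set \<Rightarrow> bool" where
  "subvariety X Y \<longleftrightarrow>
     (\<exists>Z Z'. closed_subvariety X Z \<and> closed_subvariety X Z' \<and> Y = Z - Z')"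

subsection \<open>Nonsingularity\<close>

definition vanishing_ideal :: "(complex ^ 'n) set \<Rightarrow> (complex ^ 'n \<Rightarrow> complex) set" where
  "vanishing_ideal S = {f. polyfun f \<and> (\<forall>x\<in>S. f x = 0)}"

definition grad :: "(complex ^ 'n \<Rightarrow> complex) \<Rightarrow> complex ^ 'n \<Rightarrow> complex ^ 'n" where
  "grad f p = (\<chi> j. deriv (\<lambda>t. f (p + axis j t)) 0)"

text \<open>
  \<open>S\<close> is smooth over \<open>\<complex>\<close> of relative dimension \<open>d\<close> at \<open>p\<close> (Bosch, Luetkebohmert, Raynaud,
  ``Neron models'', 2.2): locally at \<open>p\<close>, the ideal of \<open>S\<close> is generated by \<open>N - d\<close> elements whose
  differentials at \<open>p\<close> are linearly independent over \<open>\<complex>\<close>. The polynomial \<open>h\<close> below is the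
  denominator that occurs when \<open>g\<close> is expressed by the generators in the local ring at \<open>p\<close>.
\<close>

definition nonsingular_at :: "(complex ^ 'n::finite) set \<Rightarrow> nat \<Rightarrow> complex ^ 'n \<Rightarrow> bool" where
  "nonsingular_at S d p \<longleftrightarrow>
     (\<exists>F. finite F \<and> card F + d = CARD('n) \<and> F \<subseteq> vanishing_ideal S \<and>
        (\<forall>g\<in>vanishing_ideal S. \<exists>h c. polyfun h \<and> h p \<noteq> 0 \<and> (\<forall>f\<in>F. polyfun (c f)) \<and>
           (\<forall>x. h x * g x = (\<Sum>f\<in>F. c f x * f x))) \<and>
        inj_on (\<lambda>f. grad f p) F \<and> vec.independent ((\<lambda>f. grad f p) ` F))"

text \<open>\<open>Y\<close> is nonsingular and equidimensional of (complex) dimension \<open>d\<close>; \<open>Y = points X\<close> is allowed.\<close>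

definition nonsingular_of_dim :: "('a, 'n::finite, 'z) variety_scheme \<Rightarrow> 'a set \<Rightarrow> nat \<Rightarrow> bool" where
  "nonsingular_of_dim X Y d \<longleftrightarrow>
     (\<forall>(U, \<phi>)\<in>atlas X. \<forall>p\<in>Y \<inter> U. nonsingular_at (\<phi> ` (Y \<inter> U)) d (\<phi> p))"

section \<open>Real algebraic varieties\<close>

definition holomorphic_map :: "(complex ^ 'n::finite) set \<Rightarrow> (complex ^ 'n \<Rightarrow> complex ^ 'm::finite) \<Rightarrow> bool" where
  "holomorphic_map S G \<longleftrightarrow>
     (\<forall>z\<in>S. \<exists>L. (G has_derivative L) (at z) \<and> (\<forall>a v. L (a *s v) = a *s L v))"

text \<open>
  A map is anti-holomorphic if, in affine coordinates, it is locally the complex conjugate of the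
  restriction of a holomorphic map of the ambient affine spaces. The condition includes continuity
  for the analytic topology.
\<close>

definition antiholomorphic :: "('a, 'n::finite, 'z) variety_scheme \<Rightarrow> ('a \<Rightarrow> 'a) \<Rightarrow> bool" where
  "antiholomorphic X \<sigma> \<longleftrightarrow>
     (\<forall>(U, \<phi>)\<in>atlas X. \<forall>(V, \<psi>)\<in>atlas X. \<forall>p\<in>U. \<sigma> p \<in> V \<longrightarrow>
        (\<exists>S G. open S \<and> \<phi> p \<in> S \<and> holomorphic_map S G \<and>
           (\<forall>x\<in>U. \<phi> x \<in> S \<longrightarrow> \<sigma> x \<in> V \<and> \<psi> (\<sigma> x) = (\<chi> j. cnj (G (\<phi> x) $ j)))))"

record ('a, 'n::finite) real_variety = "('a, 'n) variety" +
  invol :: "'a \<Rightarrow> 'a"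

definition real_algebraic_variety :: "('a, 'n::finite) real_variety \<Rightarrow> bool" where
  "real_algebraic_variety X \<longleftrightarrow>
     algebraic_variety X \<and>
     (\<forall>p\<in>points X. invol X p \<in> points X \<and> invol X (invol X p) = p) \<and>
     antiholomorphic X (invol X)"

definition real_subvariety :: "('a, 'n::finite) real_variety \<Rightarrow> 'a set \<Rightarrow> bool" where
  "real_subvariety X Y \<longleftrightarrow> subvariety X Y \<and> invol X ` Y \<subseteq> Y"

text \<open>
  The fixed points of the involution restricted to \<open>Y\<close>; the real part of \<open>X\<close> itself is obtained for
  \<open>Y = points X\<close>.
\<close>

definition real_points :: "('a, 'n::finite) real_variety \<Rightarrow> 'a set \<Rightarrow> 'a set" where
  "real_points X Y = {p \<in> Y. invol X p = p}"

section \<open>The smooth structure on the set of complex points\<close>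

primrec Ck_on :: "nat \<Rightarrow> 'a::euclidean_space set \<Rightarrow> ('a \<Rightarrow> 'b::euclidean_space) \<Rightarrow> bool" where
  "Ck_on 0 S f \<longleftrightarrow> continuous_on S f"
| "Ck_on (Suc k) S f \<longleftrightarrow>
     (\<exists>f'. (\<forall>x\<in>S. (f has_derivative f' x) (at x)) \<and> (\<forall>v. Ck_on k S (\<lambda>x. f' x v)))"

text \<open>Meant for open sets \<open>S\<close>.\<close>

definition smooth_on :: "'a::euclidean_space set \<Rightarrow> ('a \<Rightarrow> 'b::euclidean_space) \<Rightarrow> bool" where
  "smooth_on S f \<longleftrightarrow> (\<forall>k. Ck_on k S f)"

text \<open>Smoothness on an arbitrary subset of a Euclidean space: local extendability.\<close>

definition smooth_within :: "'a::euclidean_space set \<Rightarrow> ('a \<Rightarrow> 'b::euclidean_space) \<Rightarrow> bool" where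
  "smooth_within A f \<longleftrightarrow>
     (\<forall>p\<in>A. \<exists>S F. open S \<and> p \<in> S \<and> smooth_on S F \<and> (\<forall>x\<in>A \<inter> S. f x = F x))"

definition analytic_open :: "('a, 'n::finite, 'z) variety_scheme \<Rightarrow> 'a set \<Rightarrow> bool" where
  "analytic_open X W \<longleftrightarrow>
     W \<subseteq> points X \<and>
     (\<forall>(U, \<phi>)\<in>atlas X. openin (top_of_set (\<phi> ` U)) (\<phi> ` (W \<inter> U)))"

text \<open>
  A smooth chart is a diffeomorphism from an open set (classical topology) onto an open subset of
  a real vector space \<open>E\<close>. As model spaces we take the real subspaces of \<open>\<complex>\<^sup>N\<close> instead of the spaces
  \<open>\<real>\<^sup>k\<close>: this allows every dimension up to \<open>2 N\<close>, including \<open>0\<close>.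
\<close>

definition smooth_chart ::
  "('a, 'n::finite, 'z) variety_scheme \<Rightarrow> 'a set \<Rightarrow> ('a \<Rightarrow> complex ^ 'n) \<Rightarrow> (complex ^ 'n) set \<Rightarrow> bool" where
  "smooth_chart X W \<psi> E \<longleftrightarrow>
     analytic_open X W \<and> subspace E \<and> inj_on \<psi> W \<and> openin (top_of_set E) (\<psi> ` W) \<and>
     (\<forall>(U, \<phi>)\<in>atlas X.
        smooth_within (\<phi> ` (U \<inter> W)) (\<psi> \<circ> inv_into U \<phi>) \<and>
        smooth_within (\<psi> ` (U \<inter> W)) (\<phi> \<circ> inv_into W \<psi>))"

text \<open>Submanifolds are embedded, of constant dimension \<open>k\<close>, and not necessarily closed.\<close>

definition smooth_submanifold :: "('a, 'n::finite, 'z) variety_scheme \<Rightarrow> 'a set \<Rightarrow> bool" where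
  "smooth_submanifold X S \<longleftrightarrow>
     S \<subseteq> points X \<and>
     (\<exists>k. \<forall>p\<in>S. \<exists>W \<psi> E F. smooth_chart X W \<psi> E \<and> p \<in> W \<and>
        subspace F \<and> F \<subseteq> E \<and> dim F = k \<and> \<psi> ` (S \<inter> W) = \<psi> ` W \<inter> F)"

subsection \<open>Tangent spaces and transversality\<close>

text \<open>
  Tangent vectors at \<open>p\<close> are the derivations \<open>f \<mapsto> (f \<circ> \<gamma>)'(0)\<close> of the real functions smooth near
  \<open>p\<close>, where \<open>\<gamma>\<close> is a smooth curve through \<open>p\<close>. Those with \<open>\<gamma>\<close> in \<open>S\<close> form the tangent space of a
  submanifold \<open>S\<close>, as a subspace of the tangent space of \<open>points X\<close>.
\<close>

definition smooth_function_at ::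
  "('a, 'n::finite, 'z) variety_scheme \<Rightarrow> 'a \<Rightarrow> ('a \<Rightarrow> real) \<Rightarrow> bool" where
  "smooth_function_at X p f \<longleftrightarrow>
     (\<forall>(U, \<phi>)\<in>atlas X. p \<in> U \<longrightarrow>
        (\<exists>S F. open S \<and> \<phi> p \<in> S \<and> smooth_on S F \<and> (\<forall>x\<in>U. \<phi> x \<in> S \<longrightarrow> f x = F (\<phi> x))))"

definition smooth_curve ::
  "('a, 'n::finite, 'z) variety_scheme \<Rightarrow> real \<Rightarrow> (real \<Rightarrow> 'a) \<Rightarrow> bool" where
  "smooth_curve X e \<gamma> \<longleftrightarrow>
     (\<forall>t\<in>{-e<..<e}. \<gamma> t \<in> points X \<and>
        (\<forall>(U, \<phi>)\<in>atlas X. \<gamma> t \<in> U \<longrightarrow>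
           (\<exists>d>0. \<gamma> ` {t-d<..<t+d} \<subseteq> U \<and> smooth_on {t-d<..<t+d} (\<phi> \<circ> \<gamma>))))"

definition velocity ::
  "('a, 'n::finite, 'z) variety_scheme \<Rightarrow> 'a \<Rightarrow> (real \<Rightarrow> 'a) \<Rightarrow> ('a \<Rightarrow> real) \<Rightarrow> real" where
  "velocity X p \<gamma> = (\<lambda>f. if smooth_function_at X p f then deriv (f \<circ> \<gamma>) 0 else 0)"

definition tangent_space ::
  "('a, 'n::finite, 'z) variety_scheme \<Rightarrow> 'a set \<Rightarrow> 'a \<Rightarrow> (('a \<Rightarrow> real) \<Rightarrow> real) set" where
  "tangent_space X S p =
     {velocity X p \<gamma> | \<gamma> e. e > 0 \<and> smooth_curve X e \<gamma> \<and> \<gamma> 0 = p \<and> \<gamma> ` {-e<..<e} \<subseteq> S}"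

definition transverse :: "('a, 'n::finite, 'z) variety_scheme \<Rightarrow> 'a set \<Rightarrow> 'a set \<Rightarrow> bool" where
  "transverse X V W \<longleftrightarrow>
     (\<forall>p\<in>V \<inter> W.
        {(\<lambda>f. v f + w f) | v w. v \<in> tangent_space X V p \<and> w \<in> tangent_space X W p} =
        tangent_space X (points X) p)"

end

theory Submission
  imports Defs "HOL-Complex_Analysis.Cauchy_Integral_Formula"
begin

text \<open>
  In affine coordinates \<open>\<complex>X\<close> and \<open>\<complex>Y\<close> are cut out near a point \<open>p\<close> by polynomials with independent
  differentials, so adding to them a projection onto the Zariski tangent space gives a holomorphic
  local diffeomorphism that straightens the variety; holomorphic maps are smooth by Osgood's lemma.
  At a real point \<open>conj\<close> acts on the tangent space \<open>T\<close> of \<open>\<complex>X\<close> by an antilinear involution \<open>A\<close>, and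
  averaging a chart over \<open>conj\<close> makes \<open>\<real>X\<close> the fixed space of \<open>A\<close>.

  If \<open>\<complex>Y\<close> with tangent space \<open>T\<^sub>Y\<close> is transverse to \<open>\<real>X\<close> at \<open>p\<close>, each \<open>v \<in> T\<close> is \<open>y + r\<close> with
  \<open>y \<in> T\<^sub>Y\<close> and \<open>A r = r\<close>, so \<open>v - A v = y - A y \<in> T\<^sub>Y\<close>. Applied to \<open>\<i> v\<close> this gives
  \<open>v + A v \<in> T\<^sub>Y\<close>, hence \<open>v \<in> T\<^sub>Y\<close> and \<open>T = T\<^sub>Y\<close>.
\<close>

section \<open>Holomorphic maps of several variables\<close>

text \<open>Three obstacles shape the work. \<open>holomorphic_map\<close> only asks for a
  complex-linear derivative at each point, while \<open>inverse_function_theorem\<close> asks for a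
  continuous derivative and \<open>smooth_on\<close> for derivatives of all orders; Cauchy's formula
  on complex lines closes the gap. A submanifold chart for \<open>Y\<close> must flatten
  \<open>X\<close> and \<open>Y\<close> in the same coordinates although their local equations are
  chosen independently; invariance of domain reconciles them. Tangent vectors in
  \<open>transverse\<close> are derivations, so vectors of the affine space have to be recovered
  from them by testing on linear coordinates. Dimensions are real throughout: \<open>linear\<close>,
  \<open>subspace\<close> and \<open>dim\<close> refer to \<open>*\<^sub>R\<close>, and the complex
  structure enters as separate statements about \<open>*s\<close>.\<close>

lemma scaleR_eq_smult: "r *\<^sub>R v = complex_of_real r *s (v :: complex ^ 'n)"
  unfolding vec_eq_iff vector_scaleR_component vector_smult_component
  by (simp add: scaleR_conv_of_real)

lemma bounded_linear_smult_left: "bounded_linear (\<lambda>t. t *s (v :: complex ^ 'n))"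
proof -
  have "linear (\<lambda>t. t *s v)"
    by (rule linearI) (simp_all add: vec_eq_iff algebra_simps)
  then show ?thesis by (simp add: linear_conv_bounded_linear)
qed

lemma bounded_linear_smult_right: "bounded_linear (\<lambda>v :: complex ^ 'n. t *s v)"
proof -
  have "linear (\<lambda>v :: complex ^ 'n. t *s v)"
    by (rule linearI) (simp_all add: vec_eq_iff algebra_simps)
  then show ?thesis by (simp add: linear_conv_bounded_linear)
qed

text \<open>Cauchy's formula concerns complex values, so maps are reduced to this scalar notion
  coordinate by coordinate (\<open>holomorphic_map_iff\<close>).\<close>

definition holomorphic_fun :: "(complex ^ 'n) set \<Rightarrow> (complex ^ 'n \<Rightarrow> complex) \<Rightarrow> bool" where
  "holomorphic_fun S g \<longleftrightarrow>
     (\<forall>z\<in>S. \<exists>L. (g has_derivative L) (at z) \<and> (\<forall>a v. L (a *s v) = a * L v))"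

lemma has_derivative_vec_iff:
  fixes G :: "complex ^ 'n \<Rightarrow> complex ^ 'm"
  shows "(G has_derivative L) F \<longleftrightarrow> (\<forall>j. ((\<lambda>z. G z $ j) has_derivative (\<lambda>v. L v $ j)) F)"
proof
  assume "(G has_derivative L) F"
  then show "\<forall>j. ((\<lambda>z. G z $ j) has_derivative (\<lambda>v. L v $ j)) F"
    using bounded_linear.has_derivative[OF bounded_linear_vec_nth] by blast
next
  assume *: "\<forall>j. ((\<lambda>z. G z $ j) has_derivative (\<lambda>v. L v $ j)) F"
  have eq: "(\<Sum>j\<in>UNIV. (x $ j) *s axis j 1) = x" for x :: "complex ^ 'm"
    using basis_expansion[of x] by simp
  have "((\<lambda>z. \<Sum>j\<in>UNIV. (G z $ j) *s axis j 1) has_derivative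
      (\<lambda>v. \<Sum>j\<in>UNIV. (L v $ j) *s axis j 1)) F"
    by (intro has_derivative_sum bounded_linear.has_derivative[OF bounded_linear_smult_left])
      (use * in blast)
  then show "(G has_derivative L) F" by (simp add: eq)
qed

lemma holomorphic_map_iff: "holomorphic_map S G \<longleftrightarrow> (\<forall>j. holomorphic_fun S (\<lambda>z. G z $ j))"
proof
  assume G: "holomorphic_map S G"
  show "\<forall>j. holomorphic_fun S (\<lambda>z. G z $ j)"
    unfolding holomorphic_fun_def
  proof (intro allI ballI)
    fix j z assume "z \<in> S"
    then obtain L where "(G has_derivative L) (at z)" "\<And>a v. L (a *s v) = a *s L v"
      using G unfolding holomorphic_map_def by blast
    then show "\<exists>L. ((\<lambda>z. G z $ j) has_derivative L) (at z) \<and> (\<forall>a v. L (a *s v) = a * L v)"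
      by (intro exI[of _ "\<lambda>v. L v $ j"]) (auto simp: has_derivative_vec_iff)
  qed
next
  assume G: "\<forall>j. holomorphic_fun S (\<lambda>z. G z $ j)"
  show "holomorphic_map S G"
    unfolding holomorphic_map_def
  proof
    fix z assume "z \<in> S"
    then have "\<forall>j. \<exists>L. ((\<lambda>z. G z $ j) has_derivative L) (at z) \<and> (\<forall>a v. L (a *s v) = a * L v)"
      using G unfolding holomorphic_fun_def by blast
    then obtain L where "\<And>j. ((\<lambda>z. G z $ j) has_derivative L j) (at z)"
      and "\<And>j a v. L j (a *s v) = a * L j v" by metis
    then show "\<exists>L. (G has_derivative L) (at z) \<and> (\<forall>a v. L (a *s v) = a *s L v)"
      by (intro exI[of _ "\<lambda>v. \<chi> j. L j v"]) (auto simp: has_derivative_vec_iff vec_eq_iff)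
  qed
qed

section \<open>Cauchy's formula on complex lines and Osgood's lemma\<close>

lemma has_field_derivative_along_line:
  fixes g :: "complex ^ 'n \<Rightarrow> complex"
  assumes "(g has_derivative L) (at (z + s *s v))" and "\<And>a v. L (a *s v) = a * L v"
  shows "((\<lambda>t. g (z + t *s v)) has_field_derivative L v) (at s)"
proof -
  have "((\<lambda>t. z + t *s v) has_derivative (\<lambda>t. t *s v)) (at s)"
    using has_derivative_add[OF has_derivative_const[of z]
        bounded_linear_imp_has_derivative[OF bounded_linear_smult_left[of v], of "at s"]] by simp
  from has_derivative_compose[OF this assms(1)] show ?thesis
    using assms(2) by (simp add: has_field_derivative_def mult_commute_abs)
qed

lemma holomorphic_fun_continuous_on: "holomorphic_fun S g \<Longrightarrow> continuous_on S g"
  unfolding holomorphic_fun_def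
  by (meson continuous_at_imp_continuous_on has_derivative_continuous)

lemma holomorphic_map_continuous_on: "holomorphic_map S g \<Longrightarrow> continuous_on S g"
  unfolding holomorphic_map_def
  by (meson continuous_at_imp_continuous_on has_derivative_continuous)

text \<open>The radius \<open>\<rho>\<close> is uniform in \<open>z\<close>, so a single circle can
  serve as contour for all base points near \<open>z0\<close>. This is what makes differentiation
  under the integral possible.\<close>

lemma bounded_segments:
  fixes v :: "complex ^ 'n"
  assumes "open S" "z0 \<in> S"
  obtains r \<rho> where "r > 0" "\<rho> > 0" "\<And>z t. z \<in> ball z0 r \<Longrightarrow> norm t \<le> \<rho> \<Longrightarrow> z + t *s v \<in> S"
proof -
  obtain e where e: "e > 0" "ball z0 e \<subseteq> S" using assms open_contains_ball by blast
  obtain K where K: "K > 0" "\<And>t. norm (t *s v) \<le> norm t * K"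
    using bounded_linear.pos_bounded[OF bounded_linear_smult_left] by blast
  show ?thesis
  \<comment> \<open>Half of \<open>e\<close> is spent on moving the base point, the other half on
    \<open>t *s v\<close>, whose norm is at most \<open>norm t * K\<close>.\<close>
  proof (rule that[of "e/2" "e / (2 * K)"])
    fix z and t :: complex assume *: "z \<in> ball z0 (e/2)" "norm t \<le> e / (2 * K)"
    have "norm (t *s v) \<le> norm t * K" by (rule K)
    also have "\<dots> \<le> e / 2" using *(2) K(1) by (simp add: field_simps)
    finally have "dist z0 (z + t *s v) < e"
      using *(1) norm_triangle_ineq[of "z0 - z" "- (t *s v)"]
      by (simp add: dist_norm algebra_simps)
    then show "z + t *s v \<in> S" using e(2) by auto
  qed (use e K in auto)
qed

text \<open>Cauchy's formula for the first derivative of t \<mapsto> g(z + t v) at 0 over the circle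
  of radius \<open>\<rho>\<close>. With u = \<rho> exp(2 \<pi> \<i> t) one has du = 2 \<pi> \<i> u
  dt, so g/u^2 du/(2 \<pi> \<i>) reduces to g/u dt. The integrand contains values of
  \<open>g\<close> only, no derivatives, which is the source of all further regularity.\<close>

lemma directional_derivative_integral:
  fixes z v :: "complex ^ 'n"
  assumes "\<rho> > 0" "\<And>t. norm t \<le> \<rho> \<Longrightarrow> z + t *s v \<in> S"
    and L: "\<And>z. z \<in> S \<Longrightarrow> (g has_derivative L z) (at z)"
      "\<And>z a v. z \<in> S \<Longrightarrow> L z (a *s v) = a * L z v"
  shows "((\<lambda>t. inverse (of_real \<rho> * exp (2 * of_real pi * \<i> * of_real t)) *
      g (z + (of_real \<rho> * exp (2 * of_real pi * \<i> * of_real t)) *s v)) has_integral L z v) (cbox 0 1)"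
proof -
  let ?f = "\<lambda>t. g (z + t *s v)"
  have der: "(?f has_field_derivative L (z + t *s v) v) (at t)" if "norm t \<le> \<rho>" for t
    using assms(2)[OF that] L by (intro has_field_derivative_along_line) auto
  have "continuous_on (cball 0 \<rho>) ?f"
    using der by (auto intro!: continuous_at_imp_continuous_on DERIV_isCont)
  moreover have "?f holomorphic_on ball 0 \<rho>"
    unfolding holomorphic_on_open[OF open_ball] using der by (force simp: dist_norm)
  moreover have "(0::complex) \<in> ball 0 \<rho>" using assms(1) by simp
  ultimately have "((\<lambda>u. ?f u/(u-0) ^ (Suc 1)) has_contour_integral ((2 * pi * \<i>) / (fact 1) * (deriv ^^ 1) ?f 0))
           (circlepath 0 \<rho>)"
    by (rule Cauchy_has_contour_integral_higher_derivative_circlepath)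
  moreover have "deriv ?f 0 = L z v"
    using der[of 0] assms(1) by (simp add: DERIV_imp_deriv)
  ultimately have "((\<lambda>u. ?f u/u\<^sup>2) has_contour_integral (2 * pi * \<i> * L z v)) (circlepath 0 \<rho>)"
    by (simp add: power2_eq_square)
  then have "((\<lambda>t. ?f (circlepath 0 \<rho> t) / (circlepath 0 \<rho> t)\<^sup>2 *
      (2 * pi * \<i> * \<rho> * exp (2 * of_real pi * \<i> * t))) has_integral (2 * pi * \<i> * L z v)) {0..1}"
    unfolding has_contour_integral_def
    by (rule has_integral_eq[rotated]) (simp add: vector_derivative_circlepath01)
  then have "((\<lambda>t. inverse (2 * pi * \<i>) * (?f (circlepath 0 \<rho> t) / (circlepath 0 \<rho> t)\<^sup>2 *
      (2 * pi * \<i> * \<rho> * exp (2 * of_real pi * \<i> * t)))) has_integral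
      inverse (2 * pi * \<i>) * (2 * pi * \<i> * L z v)) {0..1}"
    by (rule has_integral_mult_right)
  moreover have "inverse (2 * pi * \<i>) * (2 * pi * \<i> * L z v) = L z v"
    by (simp add: field_simps)
  moreover have "inverse (2 * pi * \<i>) * (?f (circlepath 0 \<rho> t) / (circlepath 0 \<rho> t)\<^sup>2 *
      (2 * pi * \<i> * \<rho> * exp (2 * of_real pi * \<i> * t))) =
      inverse (of_real \<rho> * exp (2 * of_real pi * \<i> * of_real t)) *
      g (z + (of_real \<rho> * exp (2 * of_real pi * \<i> * of_real t)) *s v)" for t
  proof -
    have "circlepath 0 \<rho> t = of_real \<rho> * exp (2 * of_real pi * \<i> * of_real t)"
      by (simp add: circlepath mult_ac)
    then show ?thesis
      using assms(1) by (simp add: field_simps power2_eq_square)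
  qed
  ultimately show ?thesis
    unfolding box_real by simp
qed

text \<open>By Cauchy's formula \<open>L z v\<close> is an integral over a fixed circle whose
  integrand is jointly continuous in the base point and the parameter, because the differentiable
  function \<open>g\<close> is continuous.\<close>

lemma directional_derivative_continuous:
  fixes g :: "complex ^ 'n \<Rightarrow> complex"
  assumes "open S"
    and L: "\<And>z. z \<in> S \<Longrightarrow> (g has_derivative L z) (at z)"
      "\<And>z a v. z \<in> S \<Longrightarrow> L z (a *s v) = a * L z v"
  shows "continuous_on S (\<lambda>z. L z v)"
proof (rule continuous_at_imp_continuous_on, rule ballI)
  fix z0 assume "z0 \<in> S"
  obtain r \<rho> where r: "r > 0" "\<rho> > 0" "\<And>z t. z \<in> ball z0 r \<Longrightarrow> norm t \<le> \<rho> \<Longrightarrow> z + t *s v \<in> S"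
    using bounded_segments[OF \<open>open S\<close> \<open>z0 \<in> S\<close>] by metis
  define C where "C t = of_real \<rho> * exp (2 * of_real pi * \<i> * of_real t)" for t :: real
  have C: "norm (C t) \<le> \<rho>" "C t \<noteq> 0" for t using r(2) by (auto simp: C_def norm_mult)
  have contC: "continuous_on A C" for A unfolding C_def by (intro continuous_intros)
  have int: "integral (cbox 0 1) (\<lambda>t. inverse (C t) * g (z + C t *s v)) = L z v"
    if "z \<in> ball z0 r" for z
    using directional_derivative_integral[of \<rho> z v S g L] r(2) r(3)[OF that] L
    unfolding C_def by (auto intro: integral_unique)
  have "continuous_on S g" using L by (meson continuous_at_imp_continuous_on has_derivative_continuous)
  then have "continuous_on (ball z0 r \<times> cbox 0 1) (\<lambda>p. g (fst p + C (snd p) *s v))"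
    by (rule continuous_on_compose2)
      (auto intro!: continuous_intros continuous_on_compose2[OF contC[of UNIV]] r(3) C
        bounded_linear.continuous_on[OF bounded_linear_smult_left] simp del: mem_ball)
  then have "continuous_on (ball z0 r \<times> cbox 0 1) (\<lambda>(z, t). inverse (C t) * g (z + C t *s v))"
    unfolding case_prod_beta
    by (intro continuous_intros continuous_on_compose2[OF contC[of UNIV]]) (auto simp: C)
  from integral_continuous_on_param[OF this] have "continuous_on (ball z0 r) (\<lambda>z. L z v)"
    by (rule continuous_on_eq) (rule int)
  then show "isCont (\<lambda>z. L z v) z0"
    using r(1) by (simp add: continuous_on_eq_continuous_at)
qed

lemma Blinfun_derivative:
  assumes "\<And>z. z \<in> S \<Longrightarrow> (g has_derivative L z) (at z)" "z \<in> S"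
  shows "blinfun_apply (Blinfun (L z)) = L z"
  using assms by (auto intro!: bounded_linear_Blinfun_apply has_derivative_bounded_linear)

text \<open>Osgood's lemma: differentiating Cauchy's formula under the integral sign.\<close>

lemma holomorphic_fun_directional_derivative:
  fixes g :: "complex ^ 'n \<Rightarrow> complex"
  assumes "open S"
    and L: "\<And>z. z \<in> S \<Longrightarrow> (g has_derivative L z) (at z)"
      "\<And>z a v. z \<in> S \<Longrightarrow> L z (a *s v) = a * L z v"
  shows "holomorphic_fun S (\<lambda>z. L z v)"
  unfolding holomorphic_fun_def
proof
  fix z0 assume "z0 \<in> S"
  obtain r \<rho> where r: "r > 0" "\<rho> > 0" "\<And>z t. z \<in> ball z0 r \<Longrightarrow> norm t \<le> \<rho> \<Longrightarrow> z + t *s v \<in> S"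
    using bounded_segments[OF \<open>open S\<close> \<open>z0 \<in> S\<close>] by metis
  define C where "C t = of_real \<rho> * exp (2 * of_real pi * \<i> * of_real t)" for t :: real
  have C: "norm (C t) \<le> \<rho>" "C t \<noteq> 0" for t using r(2) by (auto simp: C_def norm_mult)
  have contC: "continuous_on A C" for A unfolding C_def by (intro continuous_intros)
  have CS: "z + C t *s v \<in> S" if "z \<in> ball z0 r" for z t using r(3) that C(1) by blast
  have int: "((\<lambda>t. inverse (C t) * g (z + C t *s v)) has_integral L z v) (cbox 0 1)"
    if "z \<in> ball z0 r" for z
    using directional_derivative_integral[of \<rho> z v S g L] r(2) r(3)[OF that] L
    unfolding C_def by auto
  \<comment> \<open>\<open>leibniz_rule\<close> takes the derivative of the integrand as a jointly
    continuous family of bounded operators. In finite dimension, continuity in operator norm follows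
    from continuity in each direction, which \<open>directional_derivative_continuous\<close>
    supplies.\<close>
  define D where "D z = Blinfun (L z)" for z
  have D: "blinfun_apply (D z) = L z" if "z \<in> S" for z
    unfolding D_def using Blinfun_derivative[of S g L] L(1) that by blast
  have contD: "continuous_on S D"
  proof (rule continuous_on_blinfun_componentwise)
    fix i :: "complex ^ 'n"
    show "continuous_on S (\<lambda>z. D z i)"
      using directional_derivative_continuous[OF \<open>open S\<close> L, of i]
      by (rule continuous_on_eq) (simp_all add: D)
  qed
  define fx where "fx z t = blinfun_mult_right (inverse (C t)) o\<^sub>L D (z + C t *s v)" for z t
  have fx: "fx z t w = inverse (C t) * L (z + C t *s v) w" if "z \<in> ball z0 r" for z t w
    unfolding fx_def using D[OF CS[OF that]] by simp
  have cont_fx: "continuous_on (ball z0 r \<times> cbox 0 1) (\<lambda>(z, t). fx z t)"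
  proof -
    have "continuous_on (ball z0 r \<times> cbox 0 1) (\<lambda>p. D (fst p + C (snd p) *s v))"
      by (rule continuous_on_compose2[OF contD])
        (auto intro!: continuous_intros continuous_on_compose2[OF contC[of UNIV]] CS
          bounded_linear.continuous_on[OF bounded_linear_smult_left] simp del: mem_ball)
    moreover have "continuous_on (ball z0 r \<times> cbox 0 1)
        (\<lambda>p. blinfun_mult_right (inverse (C (snd p))))"
      by (intro bounded_linear.continuous_on[OF bounded_linear_blinfun_mult_right] continuous_intros
          continuous_on_compose2[OF contC[of UNIV]]) (auto simp: C)
    ultimately show ?thesis
      unfolding fx_def case_prod_beta
      by (intro bounded_bilinear.continuous_on[OF bounded_bilinear_blinfun_compose])
  qed
  have "((\<lambda>z. integral (cbox 0 1) (\<lambda>t. inverse (C t) * g (z + C t *s v))) has_derivative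
      integral (cbox 0 1) (fx z0)) (at z0 within ball z0 r)"
  proof (rule leibniz_rule[OF _ _ cont_fx])
    fix z t assume z: "z \<in> ball z0 r"
    have "((\<lambda>x. x + C t *s v) has_derivative (\<lambda>h. h)) (at z within ball z0 r)"
      by (auto intro!: derivative_eq_intros)
    from has_derivative_compose[OF this L(1)[OF CS[OF z]]]
    have "((\<lambda>x. g (x + C t *s v)) has_derivative L (z + C t *s v)) (at z within ball z0 r)" by simp
    moreover have "blinfun_apply (fx z t) = (\<lambda>w. inverse (C t) * L (z + C t *s v) w)"
      using fx[OF z] by blast
    ultimately show "((\<lambda>x. inverse (C t) * g (x + C t *s v)) has_derivative blinfun_apply (fx z t))
        (at z within ball z0 r)"
      by (simp add: has_derivative_mult_right)
  qed (use r int in auto)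
  then have "((\<lambda>z. L z v) has_derivative integral (cbox 0 1) (fx z0)) (at z0 within ball z0 r)"
    by (rule has_derivative_transform[rotated 2]) (simp add: r(1), rule integral_unique[OF int, symmetric])
  then have "((\<lambda>z. L z v) has_derivative integral (cbox 0 1) (fx z0)) (at z0)"
    using r(1) by (simp add: at_within_open[OF _ open_ball])
  \<comment> \<open>The derivative just found is an integral of operators. Evaluation at a vector
    commutes with the integral, so complex linearity passes from the integrand to it.\<close>
  moreover have "blinfun_apply (integral (cbox 0 1) (fx z0)) (a *s w) =
      a * blinfun_apply (integral (cbox 0 1) (fx z0)) w" for a w
  proof -
    have z0: "z0 \<in> ball z0 r" using r by simp
    have "continuous_on (cbox 0 1) (fx z0)"
      using continuous_on_compose2[OF cont_fx continuous_on_Pair[OF continuous_on_const continuous_on_id], of z0 "cbox 0 1"] z0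
      by (simp add: image_subset_iff)
    then have i: "fx z0 integrable_on cbox 0 1" by (rule integrable_continuous)
    have "(\<lambda>t. fx z0 t (a *s w)) = (\<lambda>t. a * fx z0 t w)"
      using fx[OF z0] L(2)[OF CS[OF z0]] by (auto simp: algebra_simps)
    then show ?thesis
      unfolding blinfun_apply_integral[OF i] by (simp add: integral_mult_right)
  qed
  ultimately show "\<exists>L'. ((\<lambda>z. L z v) has_derivative L') (at z0) \<and> (\<forall>a w. L' (a *s w) = a * L' w)"
    by blast
qed

lemma holomorphic_map_directional_derivative:
  fixes G :: "complex ^ 'n \<Rightarrow> complex ^ 'm"
  assumes "open S"
    and "\<And>z. z \<in> S \<Longrightarrow> (G has_derivative L z) (at z)"
    and "\<And>z a v. z \<in> S \<Longrightarrow> L z (a *s v) = a *s L z v"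
  shows "holomorphic_map S (\<lambda>z. L z v)"
  unfolding holomorphic_map_iff
proof
  fix j
  show "holomorphic_fun S (\<lambda>z. L z v $ j)"
  proof (rule holomorphic_fun_directional_derivative[OF \<open>open S\<close>, where L = "\<lambda>z v. L z v $ j"])
    fix z assume "z \<in> S"
    then show "((\<lambda>z. G z $ j) has_derivative (\<lambda>v. L z v $ j)) (at z)"
      using assms(2) by (auto simp: has_derivative_vec_iff)
  qed (simp add: assms(3))
qed

section \<open>Smoothness of holomorphic maps\<close>

lemma holomorphic_map_derivatives:
  assumes "holomorphic_map S G"
  obtains L where "\<And>z. z \<in> S \<Longrightarrow> (G has_derivative L z) (at z)"
    and "\<And>z a v. z \<in> S \<Longrightarrow> L z (a *s v) = a *s L z v"
proof -
  have "\<forall>z. \<exists>L. z \<in> S \<longrightarrow> (G has_derivative L) (at z) \<and> (\<forall>a v. L (a *s v) = a *s L v)"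
    using assms unfolding holomorphic_map_def by blast
  then show ?thesis using that by metis
qed

text \<open>Holomorphy reproduces itself under directional derivatives, so the induction on
  \<open>k\<close> has to range over all \<open>G\<close>.\<close>

lemma Ck_on_holomorphic_map: "open S \<Longrightarrow> holomorphic_map S G \<Longrightarrow> Ck_on k S G"
proof (induction k arbitrary: G)
  case 0
  then show ?case by (simp add: holomorphic_map_continuous_on)
next
  case (Suc k)
  from Suc.prems(2) obtain L where L: "\<And>z. z \<in> S \<Longrightarrow> (G has_derivative L z) (at z)"
      "\<And>z a v. z \<in> S \<Longrightarrow> L z (a *s v) = a *s L z v"
    using holomorphic_map_derivatives by blast
  have "Ck_on k S (\<lambda>z. L z v)" for v
    by (intro Suc.IH Suc.prems(1) holomorphic_map_directional_derivative[OF Suc.prems(1) L])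
  then show ?case using L(1) by auto
qed

lemma smooth_on_holomorphic_map: "open S \<Longrightarrow> holomorphic_map S G \<Longrightarrow> smooth_on S G"
  by (simp add: smooth_on_def Ck_on_holomorphic_map)

lemma Ck_on_cong:
  assumes "open S" and eq: "\<And>x. x \<in> S \<Longrightarrow> f x = g x" and "Ck_on k S f"
  shows "Ck_on k S g"
proof (cases k)
  case 0
  then show ?thesis using assms continuous_on_cong by fastforce
next
  case (Suc l)
  then obtain f' where f': "\<forall>x\<in>S. (f has_derivative f' x) (at x)" "\<forall>v. Ck_on l S (\<lambda>x. f' x v)"
    using assms(3) by auto
  have "(g has_derivative f' x) (at x)" if "x \<in> S" for x
    by (rule has_derivative_transform_within_open[of f _ x UNIV S]) (use f'(1) assms that in auto)
  then show ?thesis using f'(2) Suc by auto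
qed

lemma Ck_on_bounded_linear: "Ck_on k S f \<Longrightarrow> bounded_linear l \<Longrightarrow> Ck_on k S (\<lambda>x. l (f x))"
proof (induction k arbitrary: f)
  case 0
  then show ?case by (simp add: bounded_linear.continuous_on)
next
  case (Suc k)
  then obtain f' where f': "\<forall>x\<in>S. (f has_derivative f' x) (at x)" "\<forall>v. Ck_on k S (\<lambda>x. f' x v)"
    by auto
  have "\<forall>x\<in>S. ((\<lambda>x. l (f x)) has_derivative (\<lambda>v. l (f' x v))) (at x)"
    using f'(1) bounded_linear.has_derivative[OF Suc.prems(2)] by blast
  then show ?case using Suc.IH[OF _ Suc.prems(2)] f'(2)
    by (auto intro!: exI[of _ "\<lambda>x v. l (f' x v)"])
qed

text \<open>In direction \<open>s\<close> the derivative is the holomorphic map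
  \<open>\<lambda>z. L z (of_real s *s v)\<close> restricted to the same line, so the induction
  closes. The test curves used for tangent vectors are of this form.\<close>

lemma Ck_on_holomorphic_along_line:
  fixes G :: "complex ^ 'n \<Rightarrow> complex ^ 'm" and I :: "real set"
  assumes "open S" "\<And>t. t \<in> I \<Longrightarrow> z + of_real t *s v \<in> S"
  shows "holomorphic_map S G \<Longrightarrow> Ck_on k I (\<lambda>t. G (z + of_real t *s v))"
proof (induction k arbitrary: G)
  case 0
  have "continuous_on I (\<lambda>t. z + of_real t *s v)"
    by (intro continuous_intros bounded_linear.continuous_on[OF bounded_linear_smult_left])
  then show ?case
    using continuous_on_compose2[OF holomorphic_map_continuous_on[OF 0]] assms(2) by (auto simp: image_subset_iff)
next
  case (Suc k)
  from Suc.prems obtain L where L: "\<And>z. z \<in> S \<Longrightarrow> (G has_derivative L z) (at z)"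
      "\<And>z a v. z \<in> S \<Longrightarrow> L z (a *s v) = a *s L z v"
    using holomorphic_map_derivatives by blast
  have "((\<lambda>t. G (z + of_real t *s v)) has_derivative (\<lambda>s. L (z + of_real t *s v) (of_real s *s v))) (at t)"
    if "t \<in> I" for t
  proof -
    have "((\<lambda>t. z + of_real t *s v) has_derivative (\<lambda>s. of_real s *s v)) (at t)"
      using has_derivative_add[OF has_derivative_const[of z]
        bounded_linear_imp_has_derivative[OF
          bounded_linear_compose[OF bounded_linear_smult_left[of v] bounded_linear_of_real], of "at t"]]
      by simp
    from has_derivative_compose[OF this L(1)[OF assms(2)[OF that]]] show ?thesis .
  qed
  moreover have "Ck_on k I (\<lambda>t. L (z + of_real t *s v) (of_real s *s v))" for s
    by (rule Suc.IH[of "\<lambda>z. L z (of_real s *s v)"])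
      (rule holomorphic_map_directional_derivative[OF assms(1) L])
  ultimately show ?case
    by (auto intro!: exI[of _ "\<lambda>t s. L (z + of_real t *s v) (of_real s *s v)"])
qed

section \<open>Composition and inversion of holomorphic maps\<close>

lemma holomorphic_map_subset: "holomorphic_map S G \<Longrightarrow> T \<subseteq> S \<Longrightarrow> holomorphic_map T G"
  unfolding holomorphic_map_def by blast

lemma holomorphic_map_compose:
  assumes "holomorphic_map S G" "holomorphic_map T H" "G ` S \<subseteq> T"
  shows "holomorphic_map S (\<lambda>z. H (G z))"
  unfolding holomorphic_map_def
proof
  fix z assume "z \<in> S"
  then obtain L where L: "(G has_derivative L) (at z)" "\<And>a v. L (a *s v) = a *s L v"
    using assms(1) unfolding holomorphic_map_def by blast
  from \<open>z \<in> S\<close> have "G z \<in> T" using assms(3) by blast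
  then obtain M where M: "(H has_derivative M) (at (G z))" "\<And>a v. M (a *s v) = a *s M v"
    using assms(2) unfolding holomorphic_map_def by blast
  show "\<exists>L. ((\<lambda>z. H (G z)) has_derivative L) (at z) \<and> (\<forall>a v. L (a *s v) = a *s L v)"
    using has_derivative_compose[OF L(1) M(1)] L(2) M(2)
    by (intro exI[of _ "\<lambda>v. M (L v)"]) simp
qed

lemma holomorphic_map_add:
  assumes "holomorphic_map S G" "holomorphic_map S H"
  shows "holomorphic_map S (\<lambda>z. G z + H z)"
  unfolding holomorphic_map_def
proof
  fix z assume "z \<in> S"
  then obtain L M where "(G has_derivative L) (at z)" "\<And>a v. L (a *s v) = a *s L v"
    and "(H has_derivative M) (at z)" "\<And>a v. M (a *s v) = a *s M v"
    using assms unfolding holomorphic_map_def by meson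
  then show "\<exists>L. ((\<lambda>z. G z + H z) has_derivative L) (at z) \<and> (\<forall>a v. L (a *s v) = a *s L v)"
    by (intro exI[of _ "\<lambda>v. L v + M v"]) (simp add: has_derivative_add vec.scale_right_distrib)
qed

text \<open>The real inverse function theorem applies because the derivative of a holomorphic map is
  continuous, and an injective endomorphism in finite dimension is invertible. The inverse is
  holomorphic since its derivative is the inverse of a complex-linear bijection.\<close>

lemma holomorphic_inverse_function:
  fixes f :: "complex ^ 'n \<Rightarrow> complex ^ 'n"
  assumes "open S" "holomorphic_map S f" "p \<in> S" "(f has_derivative L) (at p)" "inj L"
  obtains U V g where "open U" "p \<in> U" "U \<subseteq> S" "open V" "homeomorphism U V f g" "holomorphic_map V g"
proof -
  obtain D where D: "\<And>z. z \<in> S \<Longrightarrow> (f has_derivative D z) (at z)"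
      "\<And>z a v. z \<in> S \<Longrightarrow> D z (a *s v) = a *s D z v"
    using holomorphic_map_derivatives[OF assms(2)] by blast
  define B where "B z = Blinfun (D z)" for z
  have B: "blinfun_apply (B z) = D z" if "z \<in> S" for z
    unfolding B_def using D(1)[OF that] by (simp add: bounded_linear_Blinfun_apply has_derivative_bounded_linear)
  have contB: "continuous_on S B"
  proof (rule continuous_on_blinfun_componentwise)
    fix i :: "complex ^ 'n"
    show "continuous_on S (\<lambda>z. B z i)"
      using holomorphic_map_continuous_on[OF holomorphic_map_directional_derivative[OF \<open>open S\<close> D, of i]]
      by (rule continuous_on_eq) (simp_all add: B)
  qed
  have "D p = L" using D(1)[OF assms(3)] assms(4) has_derivative_unique by blast
  moreover have "linear L" using assms(4) has_derivative_linear by blast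
  then obtain L' where L': "linear L'" "L' \<circ> L = id"
    using linear_injective_left_inverse[OF _ assms(5)] by blast
  have "blinfun_apply (Blinfun L') = L'"
    using L'(1) by (simp add: bounded_linear_Blinfun_apply linear_conv_bounded_linear)
  ultimately have "Blinfun L' o\<^sub>L B p = id_blinfun"
    using L'(2) B[OF assms(3)] by (intro blinfun_eqI) (simp add: fun_eq_iff)
  then obtain U V g g' where *: "open U" "U \<subseteq> S" "p \<in> U" "open V" "homeomorphism U V f g"
    and g: "\<And>y. y \<in> V \<Longrightarrow> (g has_derivative (g' y)) (at y)"
      "\<And>y. y \<in> V \<Longrightarrow> g' y = inv (blinfun_apply (B (g y)))"
      "\<And>y. y \<in> V \<Longrightarrow> bij (blinfun_apply (B (g y)))"
    using inverse_function_theorem[OF assms(1) _ contB assms(3)] D(1) B by metis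
  have "holomorphic_map V g"
    unfolding holomorphic_map_def
  proof (intro ballI exI conjI allI)
    fix y assume y: "y \<in> V"
    show "(g has_derivative (g' y)) (at y)" by (rule g(1)[OF y])
    have gS: "g y \<in> S" using * y by (auto simp: homeomorphism_def)
    have b: "bij (D (g y))" and g': "g' y = inv (D (g y))" using g(2,3)[OF y] B[OF gS] by simp_all
    fix a w
    have "D (g y) (a *s g' y w) = a *s w"
      using D(2)[OF gS] b unfolding g' by (simp add: bij_is_surj surj_f_inv_f)
    then show "g' y (a *s w) = a *s g' y w"
      using b unfolding g' by (metis bij_inv_eq_iff)
  qed
  then show ?thesis using that * by blast
qed

section \<open>Zariski tangent spaces and local equations\<close>

lemma holomorphic_fun_polyfun: "polyfun f \<Longrightarrow> holomorphic_fun S f"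
proof (induction rule: polyfun.induct)
  case (const c)
  then show ?case unfolding holomorphic_fun_def by (auto intro!: exI[of _ "\<lambda>v. 0"])
next
  case (coord i)
  then show ?case unfolding holomorphic_fun_def
    by (auto intro!: exI[of _ "\<lambda>v. v $ i"] bounded_linear_imp_has_derivative bounded_linear_vec_nth)
next
  case (add f g)
  show ?case unfolding holomorphic_fun_def
  proof
    fix z assume "z \<in> S"
    with add.IH obtain L M where "(f has_derivative L) (at z)" "\<And>a v. L (a *s v) = a * L v"
      and "(g has_derivative M) (at z)" "\<And>a v. M (a *s v) = a * M v"
      unfolding holomorphic_fun_def by meson
    then show "\<exists>L. ((\<lambda>x. f x + g x) has_derivative L) (at z) \<and> (\<forall>a v. L (a *s v) = a * L v)"
      by (intro exI[of _ "\<lambda>v. L v + M v"]) (simp add: has_derivative_add distrib_left)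
  qed
next
  case (mult f g)
  show ?case unfolding holomorphic_fun_def
  proof
    fix z assume "z \<in> S"
    with mult.IH obtain L M where "(f has_derivative L) (at z)" "\<And>a v. L (a *s v) = a * L v"
      and "(g has_derivative M) (at z)" "\<And>a v. M (a *s v) = a * M v"
      unfolding holomorphic_fun_def by meson
    then show "\<exists>L. ((\<lambda>x. f x * g x) has_derivative L) (at z) \<and> (\<forall>a v. L (a *s v) = a * L v)"
      by (intro exI[of _ "\<lambda>v. f z * M v + L v * g z"] conjI has_derivative_mult) (simp_all add: algebra_simps)
  qed
qed

lemma continuous_on_polyfun: "polyfun f \<Longrightarrow> continuous_on S f"
  using holomorphic_fun_continuous_on holomorphic_fun_polyfun by blast

lemma closed_zariski_closed:
  assumes "zariski_closed V"
  shows "closed V"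
proof -
  obtain F where F: "\<forall>f\<in>F. polyfun f" "V = {x. \<forall>f\<in>F. f x = 0}"
    using assms unfolding zariski_closed_def by blast
  have "closed {x. f x = 0}" if "f \<in> F" for f
    using F(1) that by (intro closed_Collect_eq continuous_on_polyfun continuous_on_const) auto
  moreover have "V = (\<Inter>f\<in>F. {x. f x = 0})" using F(2) by auto
  ultimately show ?thesis by auto
qed

text \<open>The bilinear pairing, not the Hermitian one: \<open>cdot (grad f p)\<close> has to be
  the complex-linear differential of \<open>f\<close> at \<open>p\<close>.\<close>

definition cdot :: "complex ^ 'n \<Rightarrow> complex ^ 'n \<Rightarrow> complex" where
  "cdot b v = (\<Sum>j\<in>UNIV. b $ j * v $ j)"

lemma cdot_simps:
  "cdot b (v + w) = cdot b v + cdot b w" "cdot b (v - w) = cdot b v - cdot b w"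
  "cdot b (a *s v) = a * cdot b v" "cdot b 0 = 0"
  by (simp_all add: cdot_def algebra_simps sum.distrib sum_subtractf sum_distrib_left)

lemma cdot_sum: "cdot b (\<Sum>i\<in>I. f i) = (\<Sum>i\<in>I. cdot b (f i))"
  by (induction I rule: infinite_finite_induct) (simp_all add: cdot_simps)

lemma has_derivative_polyfun:
  assumes "polyfun f"
  shows "(f has_derivative cdot (grad f p)) (at p)"
proof -
  from holomorphic_fun_polyfun[OF assms, of UNIV] obtain L where
    L: "(f has_derivative L) (at p)" "\<And>a v. L (a *s v) = a * L v"
    unfolding holomorphic_fun_def by blast
  have ax: "L (axis j 1) = grad f p $ j" for j
  proof -
    have eq: "(\<lambda>t. f (p + axis j t)) = (\<lambda>t. f (p + t *s axis j 1))"
      by (rule ext, rule arg_cong[where f = "\<lambda>w. f (p + w)"]) (simp add: vec_eq_iff axis_def)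
    have "((\<lambda>t. f (p + t *s axis j 1)) has_field_derivative L (axis j 1)) (at 0)"
      using L by (intro has_field_derivative_along_line) auto
    then show ?thesis unfolding grad_def vec_lambda_beta eq by (simp add: DERIV_imp_deriv)
  qed
  have exp: "L v = (\<Sum>j\<in>UNIV. v $ j * L (axis j 1))" for v
  proof -
    have "L (\<Sum>j\<in>UNIV. v $ j *s axis j 1) = (\<Sum>j\<in>UNIV. L (v $ j *s axis j 1))"
      using has_derivative_linear[OF L(1)] by (rule linear_sum)
    then show ?thesis by (simp add: basis_expansion L(2))
  qed
  have "L v = cdot (grad f p) v" for v
    unfolding exp[of v] ax cdot_def by (simp only: mult.commute)
  then have "L = cdot (grad f p)" ..
  then show ?thesis using L(1) by simp
qed

text \<open>The common kernel of the differentials of all equations, not of chosen generators. This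
  makes it monotone in \<open>S\<close>, so that the tangent space of a subvariety lies in that of
  the variety without comparing generators.\<close>

definition zariski_tangent :: "(complex ^ 'n) set \<Rightarrow> complex ^ 'n \<Rightarrow> (complex ^ 'n) set" where
  "zariski_tangent S p = {v. \<forall>g\<in>vanishing_ideal S. cdot (grad g p) v = 0}"

lemma zariski_tangent_closed:
  "0 \<in> zariski_tangent S p"
  "v \<in> zariski_tangent S p \<Longrightarrow> w \<in> zariski_tangent S p \<Longrightarrow> v + w \<in> zariski_tangent S p"
  "v \<in> zariski_tangent S p \<Longrightarrow> w \<in> zariski_tangent S p \<Longrightarrow> v - w \<in> zariski_tangent S p"
  "v \<in> zariski_tangent S p \<Longrightarrow> a *s v \<in> zariski_tangent S p"
  by (auto simp: zariski_tangent_def cdot_simps)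

lemma subspace_zariski_tangent: "subspace (zariski_tangent S p)"
  by (rule subspaceI) (simp_all add: zariski_tangent_closed scaleR_eq_smult)

lemma zariski_tangent_mono: "S \<subseteq> T \<Longrightarrow> zariski_tangent S p \<subseteq> zariski_tangent T p"
  by (auto simp: zariski_tangent_def vanishing_ideal_def)

text \<open>Every equation \<open>g\<close> of \<open>S\<close> is constantly 0 along the curve, so
  the chain rule kills its differential on the velocity.\<close>

lemma velocity_in_zariski_tangent:
  assumes "(c has_vector_derivative v) (at 0)" "e > 0" "\<And>t. t \<in> {-e<..<e} \<Longrightarrow> c t \<in> S"
  shows "v \<in> zariski_tangent S (c 0)"
  unfolding zariski_tangent_def
proof (intro CollectI ballI)
  fix g assume "g \<in> vanishing_ideal S"
  then have g: "polyfun g" "\<And>x. x \<in> S \<Longrightarrow> g x = 0" by (auto simp: vanishing_ideal_def)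
  have "((\<lambda>t. g (c t)) has_derivative (\<lambda>s. cdot (grad g (c 0)) (s *\<^sub>R v))) (at 0)"
    using assms(1) has_derivative_compose[OF _ has_derivative_polyfun[OF g(1)]]
    unfolding has_vector_derivative_def by blast
  moreover have "((\<lambda>t. g (c t)) has_derivative (\<lambda>s. 0)) (at 0)"
    by (rule has_derivative_transform_within_open[of "\<lambda>t. 0" _ _ _ "{-e<..<e}"]) (use assms g in auto)
  ultimately have "(\<lambda>s. cdot (grad g (c 0)) (s *\<^sub>R v)) = (\<lambda>s. 0)" by (rule has_derivative_unique)
  from fun_cong[OF this, of 1] show "cdot (grad g (c 0)) v = 0" by simp
qed

text \<open>Extend \<open>B\<close> to a basis. The coefficient at \<open>b'\<close> is a linear
  functional, and the vector of its values on the standard basis represents it under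
  \<open>cdot\<close>.\<close>

lemma dual_vectors:
  assumes "vec.independent B"
  obtains k where "\<And>b b'. b \<in> B \<Longrightarrow> b' \<in> B \<Longrightarrow> cdot b (k b') = (if b = b' then 1 else 0)"
proof -
  let ?E = "vec.extend_basis B"
  have E: "vec.independent ?E" "vec.span ?E = UNIV" "B \<subseteq> ?E"
    using vec.independent_extend_basis[OF assms] vec.span_extend_basis[OF assms]
      vec.extend_basis_superset[OF assms] by auto
  show ?thesis
  proof (rule that[of "\<lambda>b'. \<chi> j. vec.representation ?E (axis j 1) b'"])
    fix b b' assume b: "b \<in> B" "b' \<in> B"
    have "cdot b (\<chi> j. vec.representation ?E (axis j 1) b') =
        (\<Sum>j\<in>UNIV. vec.representation ?E (b $ j *s axis j 1) b')"
      by (simp add: cdot_def vec.representation_scale[OF E(1)] E(2))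
    also have "\<dots> = vec.representation ?E (\<Sum>j\<in>UNIV. b $ j *s axis j 1) b'"
      by (subst vec.representation_sum[OF E(1)]) (simp_all add: E(2))
    also have "\<dots> = vec.representation ?E b b'" by (simp only: basis_expansion)
    also have "\<dots> = (if b = b' then 1 else 0)"
      using vec.representation_basis[OF E(1)] b E(3) by auto
    finally show "cdot b (\<chi> j. vec.representation ?E (axis j 1) b') = (if b = b' then 1 else 0)" .
  qed
qed

lemma biorthogonal_independent:
  fixes u w :: "'i \<Rightarrow> 'a::euclidean_space"
  assumes "finite I" and dual: "\<And>i j. i \<in> I \<Longrightarrow> j \<in> I \<Longrightarrow> u i \<bullet> w j = (if i = j then 1 else 0)"
  shows "inj_on u I" "independent (u ` I)"
proof -
  show inj: "inj_on u I"
    by (rule inj_onI) (metis dual zero_neq_one)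
  show "independent (u ` I)"
  proof (rule independent_if_scalars_zero)
    fix f x assume s: "(\<Sum>x\<in>u ` I. f x *\<^sub>R x) = 0" and "x \<in> u ` I"
    then obtain j where j: "j \<in> I" "x = u j" by blast
    have "0 = (\<Sum>i\<in>I. f (u i) *\<^sub>R u i) \<bullet> w j"
      using s by (simp add: sum.reindex[OF inj] o_def)
    also have "\<dots> = (\<Sum>i\<in>I. if i = j then f (u i) else 0)"
      unfolding inner_sum_left by (rule sum.cong) (use dual j in auto)
    also have "\<dots> = f x" using j assms(1) by simp
    finally show "f x = 0" by simp
  qed (use assms(1) in simp)
qed

text \<open>A complex equation is a pair of real ones, and duality to the \<open>k i\<close> makes
  all these real equations independent. The solution space is the orthogonal complement of their
  span.\<close>

lemma dim_annihilator:
  fixes b :: "'i \<Rightarrow> complex ^ 'n"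
  assumes "finite I" and dual: "\<And>i j. i \<in> I \<Longrightarrow> j \<in> I \<Longrightarrow> cdot (b i) (k j) = (if i = j then 1 else 0)"
  shows "dim {v. \<forall>i\<in>I. cdot (b i) v = 0} + 2 * card I = 2 * CARD('n)"
proof -
  \<comment> \<open>Under the real inner product, \<open>u (i, False)\<close> and
    \<open>u (i, True)\<close> return the real and the imaginary part of
    \<open>cdot (b i) v\<close>; hence the \<open>cnj\<close>. The \<open>w q\<close> are the
    corresponding dual vectors.\<close>
  define u where "u q = (if snd q then \<i> else 1) *s (\<chi> l. cnj (b (fst q) $ l))" for q :: "'i \<times> bool"
  define w where "w q = (if snd q then \<i> else 1) *s k (fst q)" for q :: "'i \<times> bool"
  have inner: "u q \<bullet> v = Re (cnj (if snd q then \<i> else 1) * cdot (b (fst q)) v)" for q v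
    unfolding inner_vec_def u_def cdot_def sum_distrib_left Re_sum
    by (rule sum.cong) (auto simp: inner_complex_def)
  let ?J = "I \<times> (UNIV :: bool set)"
  have d: "u q \<bullet> w q' = (if q = q' then 1 else 0)" if "q \<in> ?J" "q' \<in> ?J" for q q'
    using that unfolding inner by (auto simp: w_def cdot_simps dual prod_eq_iff)
  have "finite ?J" using assms(1) by simp
  note ind = biorthogonal_independent[OF this d]
  have "dim (span (u ` ?J)) = card ?J"
    using ind by (simp add: dim_eq_card_independent card_image)
  moreover have "{v. \<forall>i\<in>I. cdot (b i) v = 0} = {y \<in> UNIV. \<forall>x \<in> span (u ` ?J). orthogonal x y}"
  proof -
    have "(\<forall>x \<in> span (u ` ?J). orthogonal x v) \<longleftrightarrow> (\<forall>i\<in>I. cdot (b i) v = 0)" for v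
    proof
      assume "\<forall>x \<in> span (u ` ?J). orthogonal x v"
      then have *: "orthogonal (u q) v" if "q \<in> ?J" for q using that by (simp add: span_base)
      show "\<forall>i\<in>I. cdot (b i) v = 0"
      proof
        fix i assume "i \<in> I"
        then show "cdot (b i) v = 0"
          using *[of "(i, False)"] *[of "(i, True)"] by (simp add: orthogonal_def inner complex_eq_iff)
      qed
    next
      assume "\<forall>i\<in>I. cdot (b i) v = 0"
      then have "orthogonal v x" if "x \<in> u ` ?J" for x
        using that by (auto simp: orthogonal_def inner_commute[of v] inner)
      then show "\<forall>x \<in> span (u ` ?J). orthogonal x v"
        using orthogonal_to_span[of _ "u ` ?J" v] by (auto simp: orthogonal_commute)
    qed
    then show ?thesis by auto
  qed
  moreover have "card ?J = 2 * card I" by (simp add: card_cartesian_product)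
  ultimately show ?thesis
    using dim_subspace_orthogonal_to_vectors[of "span (u ` ?J)" UNIV] by simp
qed

text \<open>Differentiate \<open>h x * g x = (\<Sum>f\<in>F. c f x * f x)\<close> at
  \<open>p\<close>. As \<open>g\<close> and all \<open>f\<close> vanish there, the terms with
  derivatives of \<open>h\<close> and \<open>c f\<close> drop out, and \<open>h p\<close> can be
  cancelled.\<close>

lemma zariski_tangent_generators:
  assumes "p \<in> S" "finite F" "F \<subseteq> vanishing_ideal S"
    and gen: "\<And>g. g \<in> vanishing_ideal S \<Longrightarrow> \<exists>h c. polyfun h \<and> h p \<noteq> 0 \<and> (\<forall>f\<in>F. polyfun (c f)) \<and>
           (\<forall>x. h x * g x = (\<Sum>f\<in>F. c f x * f x))"
  shows "zariski_tangent S p = {v. \<forall>f\<in>F. cdot (grad f p) v = 0}"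
proof
  show "zariski_tangent S p \<subseteq> {v. \<forall>f\<in>F. cdot (grad f p) v = 0}"
    using assms(3) by (auto simp: zariski_tangent_def)
  show "{v. \<forall>f\<in>F. cdot (grad f p) v = 0} \<subseteq> zariski_tangent S p"
    unfolding zariski_tangent_def
  proof clarify
    fix v g assume v: "\<forall>f\<in>F. cdot (grad f p) v = 0" and g: "g \<in> vanishing_ideal S"
    obtain h c where h: "polyfun h" "h p \<noteq> 0" and cp: "\<forall>f\<in>F. polyfun (c f)"
      and eq: "\<forall>x. h x * g x = (\<Sum>f\<in>F. c f x * f x)" using gen[OF g] by blast
    have c: "polyfun (c f)" if "f \<in> F" for f using cp that by blast
    have f: "polyfun f" "f p = 0" if "f \<in> F" for f
      using assms(1,3) that by (auto simp: vanishing_ideal_def)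
    have g0: "polyfun g" "g p = 0" using g assms(1) by (auto simp: vanishing_ideal_def)
    have "((\<lambda>x. h x * g x) has_derivative (\<lambda>v. h p * cdot (grad g p) v + cdot (grad h p) v * g p)) (at p)"
      by (intro has_derivative_mult has_derivative_polyfun h g0)
    moreover have "((\<lambda>x. \<Sum>f\<in>F. c f x * f x) has_derivative
        (\<lambda>v. \<Sum>f\<in>F. c f p * cdot (grad f p) v + cdot (grad (c f) p) v * f p)) (at p)"
      by (intro has_derivative_sum has_derivative_mult has_derivative_polyfun c f)
    ultimately have "(\<lambda>v. h p * cdot (grad g p) v + cdot (grad h p) v * g p) =
        (\<lambda>v. \<Sum>f\<in>F. c f p * cdot (grad f p) v + cdot (grad (c f) p) v * f p)"
      unfolding eq[rule_format] by (rule has_derivative_unique)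
    moreover have "(\<Sum>f\<in>F. c f p * cdot (grad f p) v + cdot (grad (c f) p) v * f p) = 0"
      by (rule sum.neutral) (use v f in auto)
    ultimately show "cdot (grad g p) v = 0"
      using g0 h(2) by (auto dest: fun_cong[of _ _ v])
  qed
qed

text \<open>Adding \<open>P (z - p)\<close> to \<open>R z\<close> gives a map with derivative the identity at \<open>p\<close> that maps \<open>S\<close>
  to its Zariski tangent space.\<close>

definition local_equation ::
  "(complex ^ 'n) set \<Rightarrow> complex ^ 'n \<Rightarrow> (complex ^ 'n \<Rightarrow> complex ^ 'n) \<Rightarrow> (complex ^ 'n \<Rightarrow> complex ^ 'n) \<Rightarrow> bool" where
  "local_equation S p P R \<longleftrightarrow>
     linear P \<and> (\<forall>a v. P (a *s v) = a *s P v) \<and>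
     range P \<subseteq> zariski_tangent S p \<and> (\<forall>v\<in>zariski_tangent S p. P v = v) \<and>
     holomorphic_map UNIV R \<and> (R has_derivative (\<lambda>v. v - P v)) (at p) \<and> (\<forall>z. P (R z) = 0) \<and>
     (\<exists>N. open N \<and> p \<in> N \<and> (\<forall>z\<in>N. z \<in> S \<longleftrightarrow> R z = 0)) \<and> (\<forall>z\<in>S. R z = 0)"

lemma local_equationD:
  assumes "local_equation S p P R"
  shows "linear P" "\<And>a v. P (a *s v) = a *s P v" "\<And>v. P v \<in> zariski_tangent S p"
    "\<And>v. v \<in> zariski_tangent S p \<Longrightarrow> P v = v"
    "holomorphic_map UNIV R" "(R has_derivative (\<lambda>v. v - P v)) (at p)" "\<And>z. P (R z) = 0"
    "\<And>z. z \<in> S \<Longrightarrow> R z = 0"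
  using assms by (simp_all add: local_equation_def image_subset_iff)

lemma local_equation_neighbourhood:
  assumes "local_equation S p P R"
  obtains N where "open N" "p \<in> N" "\<And>z. z \<in> N \<Longrightarrow> z \<in> S \<longleftrightarrow> R z = 0"
proof -
  have "\<exists>N. open N \<and> p \<in> N \<and> (\<forall>z\<in>N. z \<in> S \<longleftrightarrow> R z = 0)"
    using assms by (simp only: local_equation_def)
  then show ?thesis using that by blast
qed

text \<open>The independent differentials of the generators have dual vectors \<open>k f\<close>,
  which span a complement of the tangent space. The generators, used as coefficients of these
  vectors, form a single vector equation \<open>R\<close>.\<close>

lemma nonsingular_local_equation:
  fixes S :: "(complex ^ 'n) set"
  assumes "nonsingular_at S d p" "p \<in> S" "S = A - B" "zariski_closed A" "zariski_closed B"
  obtains P R where "local_equation S p P R" "dim (zariski_tangent S p) = 2 * d"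
proof -
  obtain F where F: "finite F" "card F + d = CARD('n)" "F \<subseteq> vanishing_ideal S"
    and gen: "\<And>g. g \<in> vanishing_ideal S \<Longrightarrow> \<exists>h c. polyfun h \<and> h p \<noteq> 0 \<and> (\<forall>f\<in>F. polyfun (c f)) \<and>
           (\<forall>x. h x * g x = (\<Sum>f\<in>F. c f x * f x))"
    and inj: "inj_on (\<lambda>f. grad f p) F" and ind: "vec.independent ((\<lambda>f. grad f p) ` F)"
    using assms(1) unfolding nonsingular_at_def by blast
  obtain k' where k': "\<And>b b'. b \<in> (\<lambda>f. grad f p) ` F \<Longrightarrow> b' \<in> (\<lambda>f. grad f p) ` F \<Longrightarrow>
      cdot b (k' b') = (if b = b' then 1 else 0)"
    using dual_vectors[OF ind] by blast
  define k where "k f = k' (grad f p)" for f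
  have k: "cdot (grad f p) (k f') = (if f = f' then 1 else 0)" if "f \<in> F" "f' \<in> F" for f f'
    using k' that inj unfolding k_def inj_on_def by auto
  have T: "zariski_tangent S p = {v. \<forall>f\<in>F. cdot (grad f p) v = 0}"
    by (rule zariski_tangent_generators[OF assms(2) F(1,3) gen])
  \<comment> \<open>The projection onto the tangent space along the span of the \<open>k f\<close>;
    the values of \<open>R\<close> lie in that span, so \<open>P\<close> annihilates them, and the
    derivative of \<open>R\<close> at \<open>p\<close> is the complementary projection.\<close>
  define P where "P v = v - (\<Sum>f\<in>F. cdot (grad f p) v *s k f)" for v
  define R where "R z = (\<Sum>f\<in>F. f z *s k f)" for z
  have f: "polyfun f" "\<And>z. z \<in> S \<Longrightarrow> f z = 0" if "f \<in> F" for f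
    using F(3) that by (auto simp: vanishing_ideal_def)
  have Fk: "cdot (grad f p) (\<Sum>f'\<in>F. a f' *s k f') = a f" if "f \<in> F" for f a
  proof -
    have "cdot (grad f p) (\<Sum>f'\<in>F. a f' *s k f') = (\<Sum>f'\<in>F. if f = f' then a f' else 0)"
      unfolding cdot_sum cdot_simps by (rule sum.cong) (use k that in auto)
    then show ?thesis using that F(1) by simp
  qed
  have add: "P (v + w) = P v + P w" for v w
    by (simp add: P_def cdot_simps vec.scale_left_distrib sum.distrib)
  have scale: "P (a *s v) = a *s P v" for a v
    by (simp add: P_def cdot_simps vec.scale_right_diff_distrib vec.scale_sum_right)
  have "linear P" by (rule linearI) (simp_all add: add scale scaleR_eq_smult)
  moreover have "range P \<subseteq> zariski_tangent S p"
    unfolding T by (auto simp: P_def cdot_simps Fk)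
  moreover have "\<forall>v\<in>zariski_tangent S p. P v = v"
    unfolding T by (auto simp: P_def)
  moreover have der: "(R has_derivative (\<lambda>v. \<Sum>f\<in>F. cdot (grad f z) v *s k f)) (at z)" for z
    unfolding R_def
    by (intro has_derivative_sum bounded_linear.has_derivative[OF bounded_linear_smult_left]
        has_derivative_polyfun f)
  then have "(R has_derivative (\<lambda>v. v - P v)) (at p)" by (simp add: P_def)
  moreover have "holomorphic_map UNIV R"
    unfolding holomorphic_map_def
    by (intro ballI exI conjI, rule der) (simp add: cdot_simps vec.scale_sum_right)
  moreover have "P (R z) = 0" for z
    unfolding P_def R_def by (simp add: Fk)
  moreover have R0: "R z = 0 \<longleftrightarrow> (\<forall>f\<in>F. f z = 0)" for z
  proof
    assume "R z = 0"
    then have "cdot (grad f p) (R z) = 0" for f by (simp add: cdot_simps)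
    then show "\<forall>f\<in>F. f z = 0" unfolding R_def using Fk by metis
  qed (auto simp: R_def intro!: sum.neutral)
  then have "\<forall>z\<in>S. R z = 0" using f by blast
  moreover have "\<exists>N. open N \<and> p \<in> N \<and> (\<forall>z\<in>N. z \<in> S \<longleftrightarrow> R z = 0)"
  proof -
    obtain G where G: "finite G" "\<And>g. g \<in> G \<Longrightarrow> polyfun g" "A = {x. \<forall>g\<in>G. g x = 0}"
      using assms(4) unfolding zariski_closed_def by blast
    have "g \<in> vanishing_ideal S" if "g \<in> G" for g
      using G that assms(3) by (auto simp: vanishing_ideal_def)
    then have "\<forall>g\<in>G. \<exists>h. polyfun h \<and> h p \<noteq> 0 \<and> (\<exists>c. \<forall>x. h x * g x = (\<Sum>f\<in>F. c f x * f x))"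
      using gen by meson
    from bchoice[OF this] obtain h where
      h: "\<forall>g\<in>G. polyfun (h g) \<and> h g p \<noteq> 0 \<and> (\<exists>c. \<forall>x. h g x * g x = (\<Sum>f\<in>F. c f x * f x))"
      by blast
    \<comment> \<open>Where the denominators \<open>h g\<close> are nonzero, zeros of the generators
      are zeros of the equations \<open>G\<close> of \<open>A\<close>. Leaving out the closed set
      \<open>B\<close> then gives points of \<open>S\<close>.\<close>
    define N where "N = (\<Inter>g\<in>G. {z. h g z \<noteq> 0}) \<inter> - B"
    have "open {z. h g z \<noteq> 0}" if "g \<in> G" for g
      using h that by (intro open_Collect_neq[OF continuous_on_polyfun continuous_on_const]) blast
    then have "open N" unfolding N_def
      using G(1) closed_zariski_closed[OF assms(5)] by (intro open_Int open_INT) auto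
    moreover have "p \<in> N" using h assms(2,3) by (auto simp: N_def)
    moreover have "z \<in> S" if "z \<in> N" "R z = 0" for z
    proof -
      have "g z = 0" if g: "g \<in> G" for g
      proof -
        obtain c where "h g z * g z = (\<Sum>f\<in>F. c f z * f z)" using h g by blast
        then have "h g z * g z = 0" using R0[of z] \<open>R z = 0\<close> by (simp add: sum.neutral)
        then show ?thesis using \<open>z \<in> N\<close> g by (auto simp: N_def)
      qed
      then show ?thesis using that G(3) assms(3) by (auto simp: N_def)
    qed
    ultimately show ?thesis using \<open>\<forall>z\<in>S. R z = 0\<close> by blast
  qed
  ultimately have "local_equation S p P R" unfolding local_equation_def using scale by blast
  moreover have "dim (zariski_tangent S p) = 2 * d"
    using dim_annihilator[OF F(1) k] F(2) unfolding T by simp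
  ultimately show ?thesis by (rule that)
qed

lemma holomorphic_map_linear:
  assumes "linear P" "\<And>a v. P (a *s v) = a *s P v"
  shows "holomorphic_map S (\<lambda>z. P (z - p))" "((\<lambda>z. P (z - p)) has_derivative P) (at z)"
proof -
  show *: "((\<lambda>z. P (z - p)) has_derivative P) (at z)" for z
    using bounded_linear.has_derivative[OF assms(1)[unfolded linear_conv_bounded_linear],
        OF has_derivative_diff[OF has_derivative_ident has_derivative_const]] by simp
  show "holomorphic_map S (\<lambda>z. P (z - p))"
    unfolding holomorphic_map_def using * assms(2) by blast
qed

text \<open>\<open>P\<close> annihilates \<open>R z\<close> and fixes the tangent space. So
  \<open>\<Phi> z\<close> lies in the tangent space exactly if its component \<open>R z\<close>
  vanishes, which near \<open>p\<close> means membership in \<open>S\<close>.\<close>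

lemma local_equation_straightening:
  assumes "local_equation S p P R" "p \<in> S"
  obtains U V \<Phi> \<Gamma> where "open U" "p \<in> U" "open V" "homeomorphism U V \<Phi> \<Gamma>"
    "holomorphic_map V \<Gamma>" "\<Phi> p = 0" "(\<Phi> has_derivative (\<lambda>v. v)) (at p)"
    "\<And>z. z \<in> U \<Longrightarrow> z \<in> S \<longleftrightarrow> \<Phi> z \<in> zariski_tangent S p"
proof -
  note P = local_equationD(1-4)[OF assms(1)] and R = local_equationD(5-8)[OF assms(1)]
  obtain N where N: "open N" "p \<in> N" "\<And>z. z \<in> N \<Longrightarrow> z \<in> S \<longleftrightarrow> R z = 0"
    using local_equation_neighbourhood[OF assms(1)] by blast
  define \<Phi> where "\<Phi> z = R z + P (z - p)" for z
  have hol: "holomorphic_map N \<Phi>"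
    unfolding \<Phi>_def using holomorphic_map_subset[OF R(1)] P(1,2)
    by (intro holomorphic_map_add holomorphic_map_linear) auto
  have der: "(\<Phi> has_derivative (\<lambda>v. v)) (at p)"
    unfolding \<Phi>_def using has_derivative_add[OF R(2) holomorphic_map_linear(2)[OF P(1,2)]] by simp
  obtain U V \<Gamma> where UV: "open U" "p \<in> U" "U \<subseteq> N" "open V" "homeomorphism U V \<Phi> \<Gamma>" "holomorphic_map V \<Gamma>"
    by (rule holomorphic_inverse_function[OF N(1) hol N(2) der]) auto
  show ?thesis
  proof (rule that[OF UV(1,2,4,5,6) _ der])
    show "\<Phi> p = 0" using R(4)[OF assms(2)] linear_0[OF P(1)] by (simp add: \<Phi>_def)
    fix z assume "z \<in> U"
    show "z \<in> S \<longleftrightarrow> \<Phi> z \<in> zariski_tangent S p"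
    proof
      assume "z \<in> S"
      then show "\<Phi> z \<in> zariski_tangent S p" using R(4) P(3) by (simp add: \<Phi>_def)
    next
      assume "\<Phi> z \<in> zariski_tangent S p"
      then have "P (\<Phi> z) = \<Phi> z" by (rule P(4))
      moreover have "P (\<Phi> z) = P (z - p)"
        using R(3) P(4)[OF P(3)] linear_add[OF P(1)] by (simp add: \<Phi>_def)
      ultimately have "R z = 0" by (simp add: \<Phi>_def)
      then show "z \<in> S" using N(3) UV(3) \<open>z \<in> U\<close> by blast
    qed
  qed
qed

text \<open>Converse to \<open>velocity_in_zariski_tangent\<close>: the real line through
  \<open>v\<close> in the straightened picture, pulled back by \<open>\<Gamma>\<close>. Its velocity
  is \<open>v\<close> itself because \<open>\<Phi>\<close>, and hence \<open>\<Gamma>\<close>, has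
  the identity as derivative.\<close>

lemma tangent_curve:
  assumes "local_equation S p P R" "p \<in> S" "v \<in> zariski_tangent S p"
  obtains e V \<Gamma> where "e > 0" "open V" "holomorphic_map V \<Gamma>" "\<Gamma> 0 = p"
    "\<And>t. t \<in> {-e<..<e} \<Longrightarrow> of_real t *s v \<in> V" "\<And>t. t \<in> {-e<..<e} \<Longrightarrow> \<Gamma> (of_real t *s v) \<in> S"
    "((\<lambda>t. \<Gamma> (of_real t *s v)) has_vector_derivative v) (at 0)"
proof -
  obtain U V \<Phi> \<Gamma> where U: "open U" "p \<in> U" "open V" "homeomorphism U V \<Phi> \<Gamma>"
    "holomorphic_map V \<Gamma>" "\<Phi> p = 0" "(\<Phi> has_derivative (\<lambda>v. v)) (at p)"
    "\<And>z. z \<in> U \<Longrightarrow> z \<in> S \<longleftrightarrow> \<Phi> z \<in> zariski_tangent S p"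
    using local_equation_straightening[OF assms(1,2)] by metis
  have 0: "0 \<in> V" "\<Gamma> 0 = p" using U(2,4,6) unfolding homeomorphism_def by force+
  have "open ((\<lambda>t. of_real t *s v) -` V)"
    by (rule open_vimage[OF U(3)])
      (intro bounded_linear.continuous_on[OF bounded_linear_smult_left] continuous_intros)
  moreover have "(0::real) \<in> (\<lambda>t. of_real t *s v) -` V" using 0 by simp
  ultimately obtain e where e: "e > 0" "ball 0 e \<subseteq> (\<lambda>t. of_real t *s v) -` V"
    using open_contains_ball by blast
  have V: "of_real t *s v \<in> V" if "t \<in> {-e<..<e}" for t
    using e(2) that by (auto simp: dist_norm subset_iff abs_less_iff)
  obtain L where L: "(\<Gamma> has_derivative L) (at 0)" using U(5) 0 unfolding holomorphic_map_def by blast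
  have "((\<lambda>y. \<Phi> (\<Gamma> y)) has_derivative L) (at 0)"
    using has_derivative_compose[OF L] U(7) 0 by simp
  moreover have "((\<lambda>y. \<Phi> (\<Gamma> y)) has_derivative (\<lambda>y. y)) (at 0)"
    by (rule has_derivative_transform_within_open[OF has_derivative_ident U(3) 0(1)])
      (use U(4) in \<open>auto simp: homeomorphism_def\<close>)
  ultimately have "L = (\<lambda>y. y)" by (rule has_derivative_unique)
  have "((\<lambda>t. of_real t *s v) has_derivative (\<lambda>t. of_real t *s v)) (at 0)"
    by (rule bounded_linear_imp_has_derivative[OF
          bounded_linear_compose[OF bounded_linear_smult_left bounded_linear_of_real]])
  from has_derivative_compose[OF this, of \<Gamma> L] L
  have der: "((\<lambda>t. \<Gamma> (of_real t *s v)) has_vector_derivative v) (at 0)"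
    unfolding has_vector_derivative_def \<open>L = (\<lambda>y. y)\<close> scaleR_eq_smult by simp
  have inS: "\<Gamma> (of_real t *s v) \<in> S" if "t \<in> {-e<..<e}" for t
  proof -
    have "\<Gamma> (of_real t *s v) \<in> U" "\<Phi> (\<Gamma> (of_real t *s v)) = of_real t *s v"
      using U(4) V[OF that] by (auto simp: homeomorphism_def)
    then show ?thesis using U(8) zariski_tangent_closed(4)[OF assms(3)] by simp
  qed
  show ?thesis by (rule that[OF e(1) U(3,5) 0(2) V inS der])
qed

section \<open>Charts\<close>

text \<open>Holomorphic counterpart of \<open>smooth_within\<close>. All changes of coordinates that
  occur are locally restrictions of holomorphic maps; they are composed in this class, and
  smoothness is deduced only at the end.\<close>

definition hol_within :: "(complex ^ 'n) set \<Rightarrow> (complex ^ 'n \<Rightarrow> complex ^ 'm) \<Rightarrow> bool" where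
  "hol_within A f \<longleftrightarrow>
     (\<forall>p\<in>A. \<exists>S H. open S \<and> p \<in> S \<and> holomorphic_map S H \<and> (\<forall>x\<in>A \<inter> S. f x = H x))"

lemma hol_within_smooth_within:
  assumes "hol_within A f"
  shows "smooth_within A f"
  unfolding smooth_within_def
proof
  fix p assume "p \<in> A"
  then obtain S H where "open S" "p \<in> S" "holomorphic_map S H" "\<forall>x\<in>A \<inter> S. f x = H x"
    using assms unfolding hol_within_def by blast
  then show "\<exists>S F. open S \<and> p \<in> S \<and> smooth_on S F \<and> (\<forall>x\<in>A \<inter> S. f x = F x)"
    by (intro exI[of _ S] exI[of _ H]) (simp add: smooth_on_holomorphic_map)
qed

lemma hol_within_cong_subset:
  assumes "hol_within A f" "B \<subseteq> A" "\<And>x. x \<in> B \<Longrightarrow> f x = g x"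
  shows "hol_within B g"
  unfolding hol_within_def
proof
  fix p assume "p \<in> B"
  then obtain S H where "open S" "p \<in> S" "holomorphic_map S H" "\<forall>x\<in>A \<inter> S. f x = H x"
    using assms(1,2) unfolding hol_within_def by blast
  then show "\<exists>S H. open S \<and> p \<in> S \<and> holomorphic_map S H \<and> (\<forall>x\<in>B \<inter> S. g x = H x)"
    using assms(3)[symmetric] assms(2) by (intro exI[of _ S] exI[of _ H]) auto
qed

lemma hol_within_subset: "hol_within A f \<Longrightarrow> B \<subseteq> A \<Longrightarrow> hol_within B f"
  using hol_within_cong_subset by blast

lemma hol_within_holomorphic_map: "open S \<Longrightarrow> holomorphic_map S H \<Longrightarrow> A \<subseteq> S \<Longrightarrow> hol_within A H"
  unfolding hol_within_def by blast

lemma hol_within_continuous_on: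
  assumes "hol_within A f"
  shows "continuous_on A f"
  unfolding continuous_on_eq_continuous_within
proof
  fix p assume "p \<in> A"
  then obtain S H where S: "open S" "p \<in> S" "holomorphic_map S H" "\<forall>x\<in>A \<inter> S. f x = H x"
    using assms unfolding hol_within_def by blast
  have "isCont H p"
    using holomorphic_map_continuous_on[OF S(3)] S(1,2) by (simp add: continuous_on_eq_continuous_at)
  then have "continuous (at p within A) H" by (rule continuous_at_imp_continuous_at_within)
  then show "continuous (at p within A) f"
    by (rule continuous_transform_within_openin[of _ _ _ "A \<inter> S"])
      (use S \<open>p \<in> A\<close> in \<open>auto simp: openin_open_Int\<close>)
qed

lemma hol_within_compose:
  assumes f: "hol_within A f" and g: "hol_within B g" and sub: "f ` A \<subseteq> B"
  shows "hol_within A (\<lambda>x. g (f x))"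
  unfolding hol_within_def
proof
  fix p assume "p \<in> A"
  then obtain S H where S: "open S" "p \<in> S" "holomorphic_map S H" "\<forall>x\<in>A \<inter> S. f x = H x"
    using f unfolding hol_within_def by blast
  have "f p \<in> B" using sub \<open>p \<in> A\<close> by blast
  then obtain T K where T: "open T" "f p \<in> T" "holomorphic_map T K" "\<forall>x\<in>B \<inter> T. g x = K x"
    using g unfolding hol_within_def by blast
  let ?S = "S \<inter> H -` T"
  have "open ?S"
    using continuous_open_preimage[OF holomorphic_map_continuous_on[OF S(3)] S(1) T(1)] .
  moreover have "p \<in> ?S" using S \<open>p \<in> A\<close> T(2) by auto
  moreover have "holomorphic_map ?S (\<lambda>x. K (H x))"
    by (rule holomorphic_map_compose[OF holomorphic_map_subset[OF S(3)] T(3)]) auto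
  moreover have "\<forall>x\<in>A \<inter> ?S. g (f x) = K (H x)"
    using S(4) T(4) sub by auto
  ultimately show "\<exists>S H. open S \<and> p \<in> S \<and> holomorphic_map S H \<and> (\<forall>x\<in>A \<inter> S. g (f x) = H x)"
    by blast
qed

section \<open>Regular functions as restrictions of holomorphic maps\<close>

lemma holomorphic_fun_divide:
  assumes "polyfun g" "polyfun h" "\<And>z. z \<in> S \<Longrightarrow> h z \<noteq> 0"
  shows "holomorphic_fun S (\<lambda>z. g z / h z)"
  unfolding holomorphic_fun_def
proof (intro ballI exI conjI allI)
  fix z assume "z \<in> S"
  then show "((\<lambda>z. g z / h z) has_derivative (\<lambda>v. - g z * (inverse (h z) * cdot (grad h z) v * inverse (h z)) +
      cdot (grad g z) v / h z)) (at z)"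
    using assms by (intro has_derivative_divide has_derivative_polyfun) auto
qed (simp add: cdot_simps algebra_simps)

lemma hol_within_regular:
  fixes f :: "complex ^ 'n \<Rightarrow> complex ^ 'm"
  assumes "\<And>j. regular_on A (\<lambda>z. f z $ j)"
  shows "hol_within A f"
  unfolding hol_within_def
proof
  fix p assume "p \<in> A"
  then have "\<forall>j. \<exists>g h. polyfun g \<and> polyfun h \<and> h p \<noteq> 0 \<and> (\<forall>x\<in>A. h x \<noteq> 0 \<longrightarrow> f x $ j = g x / h x)"
    using assms unfolding regular_on_def by blast
  then obtain g h where gh: "\<forall>j. polyfun (g j) \<and> polyfun (h j) \<and> h j p \<noteq> 0 \<and>
      (\<forall>x\<in>A. h j x \<noteq> 0 \<longrightarrow> f x $ j = g j x / h j x)"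
    unfolding choice_iff by blast
  define S where "S = (\<Inter>j. {z. h j z \<noteq> 0})"
  have "open {z. h j z \<noteq> 0}" for j
    using gh by (intro open_Collect_neq[OF continuous_on_polyfun continuous_on_const]) blast
  then have "open S" unfolding S_def by (intro open_INT) auto
  moreover have "p \<in> S" using gh by (simp add: S_def)
  moreover have "holomorphic_map S (\<lambda>z. \<chi> j. g j z / h j z)"
    unfolding holomorphic_map_iff using gh by (auto simp: S_def intro!: holomorphic_fun_divide)
  moreover have "\<forall>x\<in>A \<inter> S. f x = (\<chi> j. g j x / h j x)"
    using gh by (auto simp: vec_eq_iff S_def)
  ultimately show "\<exists>S H. open S \<and> p \<in> S \<and> holomorphic_map S H \<and> (\<forall>x\<in>A \<inter> S. f x = H x)"
    by blast
qed

section \<open>Simultaneous straightening of a pair\<close>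

lemma homeomorphism_open_restrict:
  assumes "homeomorphism U V f g" "open U" "open V" "open W" "W \<subseteq> U"
  shows "homeomorphism W (f ` W) f g" "open (f ` W)" "f ` W \<subseteq> V"
proof -
  show sub: "f ` W \<subseteq> V" using assms(1,5) by (auto simp: homeomorphism_def)
  show "homeomorphism W (f ` W) f g"
    using homeomorphism_of_subsets[OF assms(1,5) order_refl] assms sub by (auto simp: homeomorphism_def)
  have "openin (top_of_set V) (f ` W)"
    using homeomorphism_imp_open_map[OF assms(1)] assms(4,5) open_openin_trans assms(2) by blast
  then show "open (f ` W)" using assms(3) openin_open_trans by blast
qed

text \<open>The three summands of \<open>\<Phi>\<close> measure the distance from \<open>SX\<close>,
  the distance from \<open>SY\<close> inside \<open>SX\<close>, and the position along
  \<open>SY\<close>. Applying \<open>PX\<close> shows that \<open>\<Phi> z\<close> in the large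
  tangent space forces \<open>RX z = 0\<close>. No such computation is at hand for the small one, as
  \<open>PX\<close> and \<open>PY\<close> stem from unrelated dual vectors. There, the image of
  \<open>SY\<close> is shown to be open in its tangent space, and the domain is shrunk
  accordingly.\<close>

lemma local_equation_pair_straightening:
  fixes SX SY :: "(complex ^ 'n) set"
  assumes X: "local_equation SX p PX RX" and Y: "local_equation SY p PY RY"
    and "SY \<subseteq> SX" "p \<in> SY"
  obtains U V \<Phi> \<Gamma> where "open U" "p \<in> U" "open V" "homeomorphism U V \<Phi> \<Gamma>"
    "holomorphic_map U \<Phi>" "holomorphic_map V \<Gamma>"
    "\<And>z. z \<in> U \<Longrightarrow> z \<in> SX \<longleftrightarrow> \<Phi> z \<in> zariski_tangent SX p"
    "\<And>z. z \<in> U \<Longrightarrow> z \<in> SY \<longleftrightarrow> \<Phi> z \<in> zariski_tangent SY p"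
proof -
  let ?TX = "zariski_tangent SX p" and ?TY = "zariski_tangent SY p"
  have sub: "?TY \<subseteq> ?TX" using assms(3) by (rule zariski_tangent_mono)
  note PX = local_equationD(1-4)[OF X] and RX = local_equationD(5-8)[OF X]
    and PY = local_equationD(1-4)[OF Y] and RY = local_equationD(5-8)[OF Y]
  obtain N where N: "open N" "p \<in> N" "\<And>z. z \<in> N \<Longrightarrow> z \<in> SX \<longleftrightarrow> RX z = 0"
    using local_equation_neighbourhood[OF X] by blast
  have PXY: "PX (PY v) = PY v" for v using PX(4) PY(3) sub by blast
  \<comment> \<open>The derivative at \<open>p\<close> is
    \<open>(v - PX v) + PX (v - PY v) + PY v\<close>, which telescopes to \<open>v\<close> by
    \<open>PXY\<close>. The \<open>- 0\<close> gives the inner term the shape treated in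
    \<open>holomorphic_map_linear\<close>.\<close>
  define \<Phi> where "\<Phi> z = RX z + (PX (RY z - 0) + PY (z - p))" for z
  have hol: "holomorphic_map N \<Phi>"
    unfolding \<Phi>_def
    by (intro holomorphic_map_add holomorphic_map_linear PY
        holomorphic_map_compose[OF holomorphic_map_subset[OF RY(1)] holomorphic_map_linear(1)[OF PX(1,2), of UNIV]]
        holomorphic_map_subset[OF RX(1)]) auto
  have "((\<lambda>z. PX (RY z - 0)) has_derivative (\<lambda>v. PX (v - PY v))) (at p)"
    using has_derivative_compose[OF RY(2) holomorphic_map_linear(2)[OF PX(1,2)]] .
  from has_derivative_add[OF RX(2) has_derivative_add[OF this holomorphic_map_linear(2)[OF PY(1,2)]]]
  have der: "(\<Phi> has_derivative (\<lambda>v. v)) (at p)"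
    unfolding \<Phi>_def by (simp add: linear_diff[OF PX(1)] PXY)
  obtain U V \<Gamma> where U: "open U" "p \<in> U" "U \<subseteq> N" "open V" "homeomorphism U V \<Phi> \<Gamma>" "holomorphic_map V \<Gamma>"
    by (rule holomorphic_inverse_function[OF N(1) hol N(2) der]) auto
  have \<Phi>X: "z \<in> SX \<longleftrightarrow> \<Phi> z \<in> ?TX" if "z \<in> U" for z
  proof
    assume "z \<in> SX"
    then show "\<Phi> z \<in> ?TX" unfolding \<Phi>_def
      using RX(4) zariski_tangent_closed(2)[OF PX(3) subsetD[OF sub PY(3)]] by simp
  next
    assume "\<Phi> z \<in> ?TX"
    then have "PX (\<Phi> z) = \<Phi> z" by (rule PX(4))
    moreover have "PX (\<Phi> z) = PX (RY z - 0) + PY (z - p)"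
      unfolding \<Phi>_def linear_add[OF PX(1)] RX(3) PXY PX(4)[OF PX(3)] by simp
    ultimately have "RX z = 0" by (simp add: \<Phi>_def)
    then show "z \<in> SX" using N(3) U(3) that by blast
  qed
  have \<Phi>Y: "\<Phi> z \<in> ?TY" if "z \<in> SY" for z
    unfolding \<Phi>_def using RX(4) RY(4) PY(3) that assms(3) linear_0[OF PX(1)] by auto
  obtain U1 V1 \<Phi>1 \<Gamma>1 where U1: "open U1" "p \<in> U1" "open V1" "homeomorphism U1 V1 \<Phi>1 \<Gamma>1"
    "holomorphic_map V1 \<Gamma>1" "\<And>z. z \<in> U1 \<Longrightarrow> z \<in> SY \<longleftrightarrow> \<Phi>1 z \<in> ?TY"
    using local_equation_straightening[OF Y assms(4)] by metis
  let ?N = "U \<inter> U1"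
  have "open ?N" using U U1 by auto
  note r = homeomorphism_open_restrict[OF U1(4,1,3) this Int_lower2]
  have D: "\<Phi>1 ` (?N \<inter> SY) = \<Phi>1 ` ?N \<inter> ?TY" using U1(6) by auto
  have "\<Phi> ` (?N \<inter> SY) = (\<lambda>y. \<Phi> (\<Gamma>1 y)) ` (\<Phi>1 ` (?N \<inter> SY))"
    using U1(4) by (force simp: homeomorphism_def image_image)
  moreover have "openin (top_of_set ?TY) ((\<lambda>y. \<Phi> (\<Gamma>1 y)) ` (\<Phi>1 ` (?N \<inter> SY)))"
  \<comment> \<open>In the coordinates \<open>\<Phi>1\<close>, which straighten \<open>SY\<close>
    alone, \<open>SY\<close> is an open piece of its tangent space. \<open>\<Phi>\<close> maps this
    piece injectively and continuously into the same subspace.\<close>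
  proof (rule invariance_of_domain_subspaces[OF _ subspace_zariski_tangent subspace_zariski_tangent order_refl])
    show "openin (top_of_set ?TY) (\<Phi>1 ` (?N \<inter> SY))"
      unfolding D using r(2) by (simp add: Int_commute openin_open_Int)
    have \<Gamma>1: "\<Gamma>1 (\<Phi>1 z) = z" if "z \<in> ?N" for z using U1(4) that by (auto simp: homeomorphism_def)
    show "continuous_on (\<Phi>1 ` (?N \<inter> SY)) (\<lambda>y. \<Phi> (\<Gamma>1 y))"
      by (rule continuous_on_compose2[of U \<Phi>])
        (use U(5) U1(4) \<Gamma>1 in \<open>auto simp: homeomorphism_def intro: continuous_on_subset\<close>)
    show "(\<lambda>y. \<Phi> (\<Gamma>1 y)) \<in> \<Phi>1 ` (?N \<inter> SY) \<rightarrow> ?TY" using \<Gamma>1 \<Phi>Y by auto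
    have "inj_on \<Phi> U" using U(5) by (metis homeomorphism_def inj_on_inverseI)
    then show "inj_on (\<lambda>y. \<Phi> (\<Gamma>1 y)) (\<Phi>1 ` (?N \<inter> SY))"
      using \<Gamma>1 by (auto simp: inj_on_def)
  qed
  ultimately obtain Q where Q: "open Q" "\<Phi> ` (?N \<inter> SY) = ?TY \<inter> Q"
    by (metis openin_open)
  \<comment> \<open>Inside \<open>Q\<close>, a value in the small tangent space is already attained
    on \<open>SY\<close>; injectivity of \<open>\<Phi>\<close> then puts the point itself on
    \<open>SY\<close>.\<close>
  let ?U = "?N \<inter> \<Phi> -` Q"
  have "continuous_on ?N \<Phi>" using U(5) by (auto simp: homeomorphism_def intro: continuous_on_subset)
  then have "open ?U" using \<open>open ?N\<close> Q(1) by (rule continuous_open_preimage)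
  then have *: "homeomorphism ?U (\<Phi> ` ?U) \<Phi> \<Gamma>" "open (\<Phi> ` ?U)" "\<Phi> ` ?U \<subseteq> V"
    using homeomorphism_open_restrict[OF U(5,1,4), of ?U] by auto
  show ?thesis
  proof (rule that[OF \<open>open ?U\<close> _ *(2,1)])
    show "p \<in> ?U" using U(2) U1(2) Q(2) assms(4) by auto
    show "holomorphic_map ?U \<Phi>" by (rule holomorphic_map_subset[OF hol]) (use U(3) in auto)
    show "holomorphic_map (\<Phi> ` ?U) \<Gamma>" by (rule holomorphic_map_subset[OF U(6) *(3)])
    fix z assume z: "z \<in> ?U"
    show "z \<in> SX \<longleftrightarrow> \<Phi> z \<in> ?TX" using \<Phi>X z by blast
    show "z \<in> SY \<longleftrightarrow> \<Phi> z \<in> ?TY"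
    proof
      assume "\<Phi> z \<in> ?TY"
      with z have "\<Phi> z \<in> \<Phi> ` (?N \<inter> SY)" using Q(2) by auto
      then obtain y where y: "y \<in> ?N" "y \<in> SY" "\<Phi> z = \<Phi> y" by auto
      then have "z = y" using z U(5) by (metis IntD1 homeomorphism_def)
      with y show "z \<in> SY" by simp
    qed (rule \<Phi>Y)
  qed
qed

section \<open>Transition maps and smooth charts of a variety\<close>

lemma atlasD:
  assumes "algebraic_variety X" "(U, \<phi>) \<in> atlas X"
  shows "inj_on \<phi> U" "zariski_closed (\<phi> ` U)" "U \<subseteq> points X"
  using assms unfolding algebraic_variety_def by fast+

lemma atlas_pairD:
  fixes X :: "('a, 'n::finite, 'z) variety_scheme"
  assumes "algebraic_variety X" "(U, \<phi>) \<in> atlas X" "(V, \<psi>) \<in> atlas X"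
  shows "\<exists>Z. zariski_closed Z \<and> \<phi> ` (U \<inter> V) = \<phi> ` U - Z"
    and "regular_on (\<phi> ` (U \<inter> V)) (\<lambda>z. \<psi> (inv_into U \<phi> z) $ j)"
proof -
  have "\<forall>(U, \<phi>)\<in>atlas X. \<forall>(V, \<psi>)\<in>atlas X.
        (\<exists>Z. zariski_closed Z \<and> \<phi> ` (U \<inter> V) = \<phi> ` U - Z) \<and>
        (\<forall>j. regular_on (\<phi> ` (U \<inter> V)) (\<lambda>z. \<psi> (inv_into U \<phi> z) $ j)) \<and>
        zariski_closed ((\<lambda>x. join (\<phi> x) (\<psi> x)) ` (U \<inter> V))"
    using assms(1) unfolding algebraic_variety_def by blast
  from bspec[OF this assms(2)] have "\<forall>(V, \<psi>)\<in>atlas X.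
        (\<exists>Z. zariski_closed Z \<and> \<phi> ` (U \<inter> V) = \<phi> ` U - Z) \<and>
        (\<forall>j. regular_on (\<phi> ` (U \<inter> V)) (\<lambda>z. \<psi> (inv_into U \<phi> z) $ j)) \<and>
        zariski_closed ((\<lambda>x. join (\<phi> x) (\<psi> x)) ` (U \<inter> V))" by simp
  from bspec[OF this assms(3)]
  show "\<exists>Z. zariski_closed Z \<and> \<phi> ` (U \<inter> V) = \<phi> ` U - Z"
    and "regular_on (\<phi> ` (U \<inter> V)) (\<lambda>z. \<psi> (inv_into U \<phi> z) $ j)" by auto
qed

lemma hol_within_transition:
  assumes "algebraic_variety X" "(U, \<phi>) \<in> atlas X" "(V, \<psi>) \<in> atlas X"
  shows "hol_within (\<phi> ` (U \<inter> V)) (\<lambda>z. \<psi> (inv_into U \<phi> z))"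
  by (intro hol_within_regular atlas_pairD(2)[OF assms])

lemma inv_into_chart:
  assumes "algebraic_variety X" "(U, \<phi>) \<in> atlas X" "x \<in> U"
  shows "inv_into U \<phi> (\<phi> x) = x"
  using atlasD(1)[OF assms(1,2)] assms(3) by simp

text \<open>Zariski closed sets are closed in the classical topology. The ambient open set
  \<open>O'\<close> lets membership in \<open>V\<close> be read off from the coordinates
  \<open>\<phi> x\<close>.\<close>

lemma open_domain_of_transition:
  assumes "algebraic_variety X" "(U, \<phi>) \<in> atlas X" "(V, \<psi>) \<in> atlas X"
  obtains O' where "open O'" "\<phi> ` (U \<inter> V) = \<phi> ` U \<inter> O'" "\<And>x. x \<in> U \<Longrightarrow> \<phi> x \<in> O' \<longleftrightarrow> x \<in> V"
proof -
  obtain Z where Z: "zariski_closed Z" "\<phi> ` (U \<inter> V) = \<phi> ` U - Z"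
    using atlas_pairD(1)[OF assms] by blast
  show ?thesis
  proof (rule that[of "- Z"])
    show "open (- Z)" using closed_zariski_closed[OF Z(1)] by (simp add: open_Compl)
    show "\<phi> ` (U \<inter> V) = \<phi> ` U \<inter> - Z" using Z(2) by blast
    fix x assume x: "x \<in> U"
    have "\<phi> x \<in> - Z \<longleftrightarrow> \<phi> x \<in> \<phi> ` (U \<inter> V)" using Z(2) x by blast
    also have "\<dots> \<longleftrightarrow> x \<in> V"
      using inj_on_image_mem_iff[OF atlasD(1)[OF assms(1,2)] x, of "U \<inter> V"] x by simp
    finally show "\<phi> x \<in> - Z \<longleftrightarrow> x \<in> V" .
  qed
qed

text \<open>\<open>analytic_open\<close> tests every chart of the atlas; openness known in one chart
  is carried to the others by continuity of the transition maps.\<close>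

lemma analytic_open_chart_preimage:
  assumes X: "algebraic_variety X" "(U, \<phi>) \<in> atlas X" and "open Q"
  shows "analytic_open X {x \<in> U. \<phi> x \<in> Q}"
  unfolding analytic_open_def
proof (intro conjI)
  let ?W = "{x \<in> U. \<phi> x \<in> Q}"
  show "?W \<subseteq> points X" using atlasD(3)[OF X] by blast
  show "\<forall>(V, \<psi>)\<in>atlas X. openin (top_of_set (\<psi> ` V)) (\<psi> ` (?W \<inter> V))"
  proof clarify
    fix V \<psi> assume V: "(V, \<psi>) \<in> atlas X"
    let ?f = "\<lambda>z. \<phi> (inv_into V \<psi> z)"
    obtain O' where O': "open O'" "\<psi> ` (V \<inter> U) = \<psi> ` V \<inter> O'"
      using open_domain_of_transition[OF X(1) V X(2)] by metis
    have "openin (top_of_set (\<psi> ` (V \<inter> U))) (\<psi> ` (V \<inter> U) \<inter> ?f -` Q)"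
      using continuous_openin_preimage_gen[OF hol_within_continuous_on \<open>open Q\<close>]
        hol_within_transition[OF X(1) V X(2)] by blast
    moreover have "openin (top_of_set (\<psi> ` V)) (\<psi> ` (V \<inter> U))"
      unfolding O'(2) using O'(1) by (rule openin_open_Int)
    ultimately have "openin (top_of_set (\<psi> ` V)) (\<psi> ` (V \<inter> U) \<inter> ?f -` Q)"
      by (rule openin_trans)
    moreover have "\<psi> ` (?W \<inter> V) = \<psi> ` (V \<inter> U) \<inter> ?f -` Q"
      using inv_into_chart[OF X(1) V] by auto
    ultimately show "openin (top_of_set (\<psi> ` V)) (\<psi> ` (?W \<inter> V))" by simp
  qed
qed

text \<open>Source of all smooth charts below, those for subvarieties and those for real points. An
  ambient biholomorphism that flattens the affine image of \<open>U\<close> to \<open>E\<close>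
  restricts to a chart with values in \<open>E\<close>, and its changes of coordinates are
  compositions of \<open>\<Phi>\<close>, \<open>\<Gamma>\<close> and transition maps.\<close>

lemma smooth_chart_of_straightening:
  assumes X: "algebraic_variety X" "(U, \<phi>) \<in> atlas X"
    and D: "open D" "open D'" "homeomorphism D D' \<Phi> \<Gamma>" "holomorphic_map D \<Phi>" "holomorphic_map D' \<Gamma>"
    and E: "subspace E" "\<And>z. z \<in> D \<Longrightarrow> z \<in> \<phi> ` U \<longleftrightarrow> \<Phi> z \<in> E"
  shows "smooth_chart X {x \<in> U. \<phi> x \<in> D} (\<Phi> \<circ> \<phi>) E"
    (is "smooth_chart X ?W ?\<psi> E")
  unfolding smooth_chart_def
proof (intro conjI)
  note inv = inv_into_chart[OF X]
  have \<Gamma>\<Phi>: "\<Gamma> (\<Phi> z) = z" "\<Phi> z \<in> D'" if "z \<in> D" for z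
    using D(3) that by (auto simp: homeomorphism_def)
  have \<Phi>\<Gamma>: "\<Phi> (\<Gamma> y) = y" "\<Gamma> y \<in> D" if "y \<in> D'" for y
    using D(3) that by (auto simp: homeomorphism_def)
  have inv\<psi>: "inv_into U \<phi> (\<Gamma> (?\<psi> x)) = x" if "x \<in> ?W" for x
    using that \<Gamma>\<Phi> inv by simp
  show "analytic_open X ?W" by (rule analytic_open_chart_preimage[OF X D(1)])
  show "subspace E" by (rule E)
  show inj: "inj_on ?\<psi> ?W" by (rule inj_on_inverseI[where g = "\<lambda>y. inv_into U \<phi> (\<Gamma> y)"]) (rule inv\<psi>)
  have "?\<psi> ` ?W = E \<inter> D'"
  proof (intro equalityI subsetI)
    fix y assume "y \<in> ?\<psi> ` ?W"
    then show "y \<in> E \<inter> D'" using E(2) \<Gamma>\<Phi>(2) by auto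
  next
    fix y assume y: "y \<in> E \<inter> D'"
    then have "\<Gamma> y \<in> \<phi> ` U" using E(2)[of "\<Gamma> y"] \<Phi>\<Gamma> by simp
    then obtain x where x: "x \<in> U" "\<Gamma> y = \<phi> x" by blast
    moreover have "?\<psi> x = y" "\<phi> x \<in> D" using x \<Phi>\<Gamma>[of y] y by auto
    ultimately show "y \<in> ?\<psi> ` ?W" by (intro image_eqI[of _ _ x]) auto
  qed
  then show "openin (top_of_set E) (?\<psi> ` ?W)" using D(2) by (simp add: openin_open_Int)
  show "\<forall>(V, \<theta>)\<in>atlas X.
        smooth_within (\<theta> ` (V \<inter> ?W)) (?\<psi> \<circ> inv_into V \<theta>) \<and>
        smooth_within (?\<psi> ` (V \<inter> ?W)) (\<theta> \<circ> inv_into ?W ?\<psi>)"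
  proof clarify
    fix V \<theta> assume V: "(V, \<theta>) \<in> atlas X"
    note invV = inv_into_chart[OF X(1) V]
    have "hol_within (\<theta> ` (V \<inter> ?W)) (\<lambda>z. \<Phi> (\<phi> (inv_into V \<theta> z)))"
    proof (rule hol_within_compose[where B = D and f = "\<lambda>z. \<phi> (inv_into V \<theta> z)" and g = \<Phi>])
      show "hol_within (\<theta> ` (V \<inter> ?W)) (\<lambda>z. \<phi> (inv_into V \<theta> z))"
        by (rule hol_within_subset[OF hol_within_transition[OF X(1) V X(2)]]) auto
      show "hol_within D \<Phi>" by (rule hol_within_holomorphic_map[OF D(1,4) order_refl])
    qed (use invV in auto)
    then have 1: "hol_within (\<theta> ` (V \<inter> ?W)) (?\<psi> \<circ> inv_into V \<theta>)" by (simp add: o_def)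
    have "hol_within (?\<psi> ` (V \<inter> ?W)) (\<lambda>y. \<theta> (inv_into U \<phi> (\<Gamma> y)))"
    proof (rule hol_within_compose[where B = "\<phi> ` (U \<inter> V)" and f = \<Gamma> and g = "\<lambda>z. \<theta> (inv_into U \<phi> z)"])
      show "hol_within (?\<psi> ` (V \<inter> ?W)) \<Gamma>"
        by (rule hol_within_holomorphic_map[OF D(2,5)]) (use \<Gamma>\<Phi> in auto)
      show "hol_within (\<phi> ` (U \<inter> V)) (\<lambda>z. \<theta> (inv_into U \<phi> z))"
        by (rule hol_within_transition[OF X V])
    qed (use \<Gamma>\<Phi> in auto)
    moreover have "\<theta> (inv_into U \<phi> (\<Gamma> y)) = (\<theta> \<circ> inv_into ?W ?\<psi>) y" if "y \<in> ?\<psi> ` (V \<inter> ?W)" for y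
    proof -
      obtain x where x: "x \<in> ?W" "y = ?\<psi> x" using \<open>y \<in> ?\<psi> ` (V \<inter> ?W)\<close> by blast
      have "inv_into ?W ?\<psi> y = x" unfolding x(2) by (rule inv_into_f_f[OF inj x(1)])
      then show ?thesis using inv\<psi>[OF x(1)] x(2) by simp
    qed
    ultimately have 2: "hol_within (?\<psi> ` (V \<inter> ?W)) (\<theta> \<circ> inv_into ?W ?\<psi>)"
      by (rule hol_within_cong_subset[OF _ order_refl])
    show "smooth_within (\<theta> ` (V \<inter> ?W)) (?\<psi> \<circ> inv_into V \<theta>) \<and>
        smooth_within (?\<psi> ` (V \<inter> ?W)) (\<theta> \<circ> inv_into ?W ?\<psi>)"
      using 1 2 by (simp add: hol_within_smooth_within)
  qed
qed

section \<open>Nonsingular subvarieties as submanifolds\<close>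

lemma chart_image_locally_closed:
  assumes X: "algebraic_variety X" "(U, \<phi>) \<in> atlas X" and Y: "subvariety X Y"
  obtains A B where "\<phi> ` (Y \<inter> U) = A - B" "zariski_closed A" "zariski_closed B"
proof -
  obtain Z Z' where Z: "closed_subvariety X Z" "closed_subvariety X Z'" "Y = Z - Z'"
    using Y unfolding subvariety_def by blast
  have inj: "inj_on \<phi> U" by (rule atlasD(1)[OF X])
  have "\<phi> ` (Y \<inter> U) = \<phi> ` ((Z \<inter> U) - (Z' \<inter> U))" using Z(3) by (metis Diff_Int_distrib2)
  also have "\<dots> = \<phi> ` (Z \<inter> U) - \<phi> ` (Z' \<inter> U)"
    by (rule inj_on_image_set_diff[OF inj]) auto
  finally have "\<phi> ` (Y \<inter> U) = \<phi> ` (Z \<inter> U) - \<phi> ` (Z' \<inter> U)" .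
  moreover have "zariski_closed (\<phi> ` (Z \<inter> U))" "zariski_closed (\<phi> ` (Z' \<inter> U))"
    using Z(1,2) X(2) unfolding closed_subvariety_def by auto
  ultimately show ?thesis by (rule that)
qed

lemma local_equation_subvariety:
  assumes "algebraic_variety X" "(U, \<phi>) \<in> atlas X" "subvariety X Y" "nonsingular_of_dim X Y d" "x \<in> Y \<inter> U"
  obtains P R where "local_equation (\<phi> ` (Y \<inter> U)) (\<phi> x) P R"
    "dim (zariski_tangent (\<phi> ` (Y \<inter> U)) (\<phi> x)) = 2 * d"
proof -
  have ns: "nonsingular_at (\<phi> ` (Y \<inter> U)) d (\<phi> x)"
    using assms(2,4,5) unfolding nonsingular_of_dim_def by blast
  obtain A B where AB: "\<phi> ` (Y \<inter> U) = A - B" "zariski_closed A" "zariski_closed B"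
    using chart_image_locally_closed[OF assms(1-3)] by blast
  have "\<phi> x \<in> \<phi> ` (Y \<inter> U)" using assms(5) by blast
  then show ?thesis using nonsingular_local_equation[OF ns _ AB] that by blast
qed

lemma zariski_closed_empty: "zariski_closed {}"
  unfolding zariski_closed_def by (rule exI[of _ "{\<lambda>x. 1}"]) (auto intro: polyfun.const)

lemma subvariety_points:
  assumes "algebraic_variety X"
  shows "subvariety X (points X)"
proof -
  have "points X \<inter> U = U" if "(U, \<phi>) \<in> atlas X" for U \<phi>
    using atlasD(3)[OF assms that] by blast
  then have "closed_subvariety X (points X)"
    unfolding closed_subvariety_def using atlasD(2)[OF assms] by auto
  moreover have "closed_subvariety X {}"
    unfolding closed_subvariety_def using zariski_closed_empty by auto
  ultimately show ?thesis unfolding subvariety_def by blast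
qed

lemma subvariety_subset: "subvariety X Y \<Longrightarrow> Y \<subseteq> points X"
  unfolding subvariety_def closed_subvariety_def by blast

lemma atlas_covers:
  assumes "algebraic_variety X" "x \<in> points X"
  obtains U \<phi> where "(U, \<phi>) \<in> atlas X" "x \<in> U"
proof -
  have "points X = (\<Union>(U, \<phi>)\<in>atlas X. U)"
    using assms(1) unfolding algebraic_variety_def by (elim conjE)
  then show ?thesis using assms(2) that by auto
qed

lemma smooth_submanifold_subvariety:
  assumes X: "algebraic_variety X" "nonsingular_of_dim X (points X) dX"
    and Y: "subvariety X Y" "nonsingular_of_dim X Y dY"
  shows "smooth_submanifold X Y"
  unfolding smooth_submanifold_def
\<comment> \<open>Submanifold dimensions are real dimensions, hence the factor 2.\<close>
proof (intro conjI exI[of _ "2 * dY"] ballI)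
  show sub: "Y \<subseteq> points X" by (rule subvariety_subset[OF Y(1)])
  fix p assume p: "p \<in> Y"
  then obtain U \<phi> where U: "(U, \<phi>) \<in> atlas X" "p \<in> U" using atlas_covers[OF X(1)] sub by blast
  have XU: "points X \<inter> U = U" using atlasD(3)[OF X(1) U(1)] by blast
  let ?SX = "\<phi> ` U" and ?SY = "\<phi> ` (Y \<inter> U)"
  have pY: "p \<in> Y \<inter> U" using p U(2) by blast
  obtain PX RX where LX: "local_equation ?SX (\<phi> p) PX RX"
    using local_equation_subvariety[OF X(1) U(1) subvariety_points[OF X(1)] X(2), of p, unfolded XU, OF U(2)]
    by metis
  obtain PY RY where LY: "local_equation ?SY (\<phi> p) PY RY" "dim (zariski_tangent ?SY (\<phi> p)) = 2 * dY"
    by (rule local_equation_subvariety[OF X(1) U(1) Y pY])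
  let ?TX = "zariski_tangent ?SX (\<phi> p)" and ?TY = "zariski_tangent ?SY (\<phi> p)"
  have "\<phi> p \<in> ?SY" using p U(2) by blast
  then obtain D D' \<Phi> \<Gamma> where D: "open D" "\<phi> p \<in> D" "open D'" "homeomorphism D D' \<Phi> \<Gamma>"
    "holomorphic_map D \<Phi>" "holomorphic_map D' \<Gamma>"
    "\<And>z. z \<in> D \<Longrightarrow> z \<in> ?SX \<longleftrightarrow> \<Phi> z \<in> ?TX" "\<And>z. z \<in> D \<Longrightarrow> z \<in> ?SY \<longleftrightarrow> \<Phi> z \<in> ?TY"
    using local_equation_pair_straightening[OF LX LY(1)] by blast
  let ?W = "{x \<in> U. \<phi> x \<in> D}"
  have "smooth_chart X ?W (\<Phi> \<circ> \<phi>) ?TX"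
    by (rule smooth_chart_of_straightening[OF X(1) U(1) D(1,3,4,5,6) subspace_zariski_tangent D(7)])
  moreover have "(\<Phi> \<circ> \<phi>) ` (Y \<inter> ?W) = (\<Phi> \<circ> \<phi>) ` ?W \<inter> ?TY"
  proof (intro equalityI subsetI)
    fix y assume "y \<in> (\<Phi> \<circ> \<phi>) ` ?W \<inter> ?TY"
    then obtain x where x: "x \<in> ?W" "y = \<Phi> (\<phi> x)" "\<Phi> (\<phi> x) \<in> ?TY" by auto
    then have "\<phi> x \<in> ?SY" using D(8) by blast
    then have "x \<in> Y"
      using inj_on_image_mem_iff[OF atlasD(1)[OF X(1) U(1)], of x "Y \<inter> U"] x(1) by auto
    then show "y \<in> (\<Phi> \<circ> \<phi>) ` (Y \<inter> ?W)" using x by auto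
  qed (use D(8) in auto)
  moreover have "?TY \<subseteq> ?TX" by (rule zariski_tangent_mono) auto
  ultimately show "\<exists>W \<psi> E F. smooth_chart X W \<psi> E \<and> p \<in> W \<and>
        subspace F \<and> F \<subseteq> E \<and> dim F = 2 * dY \<and> \<psi> ` (Y \<inter> W) = \<psi> ` W \<inter> F"
    using U(2) D(2) LY(2) subspace_zariski_tangent
    by (intro exI[of _ ?W] exI[of _ "\<Phi> \<circ> \<phi>"] exI[of _ ?TX] exI[of _ ?TY]) simp
qed

section \<open>Real structures\<close>

definition vcnj :: "complex ^ 'n \<Rightarrow> complex ^ 'n" where
  "vcnj v = (\<chi> j. cnj (v $ j))"

lemma vcnj_simps:
  "vcnj (v + w) = vcnj v + vcnj w" "vcnj (a *s v) = cnj a *s vcnj v"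
  by (simp_all add: vcnj_def vec_eq_iff)

lemma linear_vcnj: "linear vcnj"
  by (rule linearI) (simp_all add: vcnj_simps scaleR_eq_smult)

lemma has_derivative_vcnj: "(f has_derivative f') F \<Longrightarrow> ((\<lambda>x. vcnj (f x)) has_derivative (\<lambda>v. vcnj (f' v))) F"
  using bounded_linear.has_derivative linear_vcnj linear_conv_bounded_linear by blast

text \<open>\<open>T\<close> is the direct sum of the fixed space F and \<i> F: by antilinearity
  \<open>A\<close> acts as -1 on \<i> F, and multiplication by \<i> is a real isomorphism between
  the two summands.\<close>

lemma dim_fixed_points_antilinear:
  fixes T :: "(complex ^ 'n) set"
  assumes T: "subspace T" "\<And>a v. v \<in> T \<Longrightarrow> a *s v \<in> T"
    and A: "linear A" "\<And>a v. A (a *s v) = cnj a *s A v"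
    and AT: "\<And>v. v \<in> T \<Longrightarrow> A v \<in> T" "\<And>v. v \<in> T \<Longrightarrow> A (A v) = v"
  shows "subspace {v \<in> T. A v = v}" "dim T = 2 * dim {v \<in> T. A v = v}"
proof -
  let ?F = "{v \<in> T. A v = v}"
  let ?J = "\<lambda>v :: complex ^ 'n. \<i> *s v"
  show F: "subspace ?F"
    using T(1) by (auto intro!: subspaceI simp: subspace_0 subspace_add subspace_scale
        linear_0[OF A(1)] linear_add[OF A(1)] linear_scale[OF A(1)])
  have J: "linear ?J" using bounded_linear_smult_right linear_conv_bounded_linear by blast
  have JJ: "?J (?J v) = - v" for v :: "complex ^ 'n" by (simp add: vec_eq_iff)
  have injJ: "inj ?J" by (rule injI) (simp add: vec_eq_iff)
  have "dim {x + y |x y. x \<in> ?F \<and> y \<in> ?J ` ?F} + dim (?F \<inter> ?J ` ?F) = dim ?F + dim (?J ` ?F)"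
    by (rule dim_sums_Int[OF F linear_subspace_image[OF J F]])
  moreover have "dim (?J ` ?F) = dim ?F"
    by (rule dim_image_eq[OF J]) (use injJ in \<open>auto intro: inj_on_subset\<close>)
  moreover have "?F \<inter> ?J ` ?F \<subseteq> {0}"
  proof
    fix v assume "v \<in> ?F \<inter> ?J ` ?F"
    then obtain w where w: "A v = v" "v = ?J w" "A w = w" by auto
    have "A v = - v" unfolding w(2) A(2) w(3) by (simp add: vec_eq_iff)
    with w(1) have "v $ j = - v $ j" for j by (metis vector_uminus_component)
    then show "v \<in> {0}" by (simp add: vec_eq_iff)
  qed
  then have "dim (?F \<inter> ?J ` ?F) = 0" by (simp add: dim_eq_0)
  moreover have "{x + y |x y. x \<in> ?F \<and> y \<in> ?J ` ?F} = T"
  proof (intro equalityI subsetI)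
    fix v assume "v \<in> {x + y |x y. x \<in> ?F \<and> y \<in> ?J ` ?F}"
    then show "v \<in> T" using T by (auto intro: subspace_add)
  next
    fix v assume v: "v \<in> T"
    define x where "x = (1/2) *s (v + A v)"
    \<comment> \<open>By antilinearity the imaginary factor changes sign under \<open>A\<close>, as
      does \<open>v - A v\<close>, so \<open>y\<close> is fixed.\<close>
    define y where "y = (- \<i>/2) *s (v - A v)"
    have "x \<in> ?F"
      using v T AT by (simp add: x_def A(2) linear_add[OF A(1)] subspace_add add.commute)
    moreover have "y \<in> ?F"
      using v T AT by (simp add: y_def A(2) linear_diff[OF A(1)] subspace_diff)
    moreover have "v = x + ?J y" by (simp add: x_def y_def vec_eq_iff field_simps)
    ultimately show "v \<in> {x + y |x y. x \<in> ?F \<and> y \<in> ?J ` ?F}" by blast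
  qed
  ultimately show "dim T = 2 * dim ?F" by simp
qed

text \<open>As \<open>p\<close> is fixed by the involution, one chart can serve both as source and
  as target: near \<open>p\<close> the involution is \<open>vcnj\<close> after the holomorphic map
  \<open>G\<close>.\<close>

locale real_structure_chart =
  fixes X :: "('a, 'n::finite) real_variety" and U \<phi> p S G L
  assumes X: "real_algebraic_variety X" and U: "(U, \<phi>) \<in> atlas X"
    and p: "p \<in> U" "invol X p = p"
    and S: "open S" "\<phi> p \<in> S" and G: "holomorphic_map S G"
    and G_eq: "\<And>x. x \<in> U \<Longrightarrow> \<phi> x \<in> S \<Longrightarrow> invol X x \<in> U \<and> \<phi> (invol X x) = vcnj (G (\<phi> x))"
    and L: "(G has_derivative L) (at (\<phi> p))" "\<And>a v. L (a *s v) = a *s L v"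
begin

text \<open>The differential of the involution at \<open>p\<close>, extended to the ambient space.
  Since \<open>G\<close> is tied to the involution only on the image of \<open>U\<close>, the
  identity \<open>A (A v) = v\<close> is obtained only for tangent vectors
  (\<open>A_tangent\<close>).\<close>

definition "A v = vcnj (L v)"

lemma alg: "algebraic_variety X"
  using X by (simp add: real_algebraic_variety_def)

lemma invol_invol: "x \<in> U \<Longrightarrow> invol X (invol X x) = x"
  using X atlasD(3)[OF alg U] by (auto simp: real_algebraic_variety_def)

lemma linear_A: "linear A"
  using linear_compose[OF has_derivative_linear[OF L(1)] linear_vcnj] by (simp add: A_def[abs_def] o_def)

lemma A_smult: "A (a *s v) = cnj a *s A v"
  by (simp add: A_def L(2) vcnj_simps)

text \<open>The chain rule for the involution, in a form that can be iterated: the conclusion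
  supplies for the image curve what is assumed of \<open>\<gamma>\<close>, namely a velocity at 0
  and values in \<open>U\<close> near 0. The interval shrinks to keep the curve inside
  \<open>S\<close>.\<close>

lemma velocity_invol:
  assumes c: "((\<lambda>t. \<phi> (\<gamma> t)) has_vector_derivative w) (at 0)" and "\<gamma> 0 = p" "d > 0"
    and U\<gamma>: "\<And>t. t \<in> {-d<..<d} \<Longrightarrow> \<gamma> t \<in> U"
  obtains d' where "d' > 0" "d' \<le> d" "\<And>t. t \<in> {-d'<..<d'} \<Longrightarrow> invol X (\<gamma> t) \<in> U"
    "((\<lambda>t. \<phi> (invol X (\<gamma> t))) has_vector_derivative A w) (at (0::real))"
proof -
  obtain e where e: "e > 0" "ball (\<phi> p) e \<subseteq> S" using S open_contains_ball by blast
  have "continuous (at 0) (\<lambda>t. \<phi> (\<gamma> t))" by (rule has_vector_derivative_continuous[OF c])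
  then obtain d1 where d1: "d1 > 0" "\<And>t. dist t 0 < d1 \<Longrightarrow> dist (\<phi> (\<gamma> t)) (\<phi> (\<gamma> 0)) < e"
    unfolding continuous_at_eps_delta using e(1) by metis
  define d' where "d' = min d d1"
  have inS: "\<phi> (\<gamma> t) \<in> S" if "t \<in> {-d'<..<d'}" for t
  proof -
    have "dist t 0 < d1" using that by (auto simp: d'_def dist_norm)
    then have "\<phi> (\<gamma> t) \<in> ball (\<phi> p) e" using d1(2)[of t] \<open>\<gamma> 0 = p\<close> by (simp add: dist_commute)
    then show ?thesis using e(2) by blast
  qed
  have inU: "\<gamma> t \<in> U" if "t \<in> {-d'<..<d'}" for t
    using that U\<gamma> by (auto simp: d'_def)
  have "((\<lambda>t. vcnj (G (\<phi> (\<gamma> t)))) has_derivative (\<lambda>s. vcnj (L (s *\<^sub>R w)))) (at 0)"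
    by (rule has_derivative_vcnj, rule has_derivative_compose[of "\<lambda>t. \<phi> (\<gamma> t)"])
      (use c L(1) \<open>\<gamma> 0 = p\<close> in \<open>simp_all add: has_vector_derivative_def\<close>)
  then have "((\<lambda>t. vcnj (G (\<phi> (\<gamma> t)))) has_vector_derivative A w) (at 0)"
    unfolding has_vector_derivative_def A_def[symmetric] linear_scale[OF linear_A] .
  then have "((\<lambda>t. \<phi> (invol X (\<gamma> t))) has_vector_derivative A w) (at 0)"
    by (rule has_vector_derivative_transform_within_open[of _ _ _ "{-d'<..<d'}"])
      (use \<open>d > 0\<close> d1(1) inS inU G_eq in \<open>auto simp: d'_def\<close>)
  moreover have "invol X (\<gamma> t) \<in> U" if "t \<in> {-d'<..<d'}" for t
    using inS[OF that] inU[OF that] G_eq by blast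
  ultimately show ?thesis
    using that[of d'] \<open>d > 0\<close> d1(1) by (simp add: d'_def)
qed

end

locale nonsingular_real_structure_chart = real_structure_chart +
  fixes P R d
  assumes P: "local_equation (\<phi> ` U) (\<phi> p) P R"
    and dim: "dim (zariski_tangent (\<phi> ` U) (\<phi> p)) = 2 * d"
begin

abbreviation "T \<equiv> zariski_tangent (\<phi> ` U) (\<phi> p)"

text \<open>Realise \<open>v\<close> by a curve in \<open>X\<close> and apply the involution to it
  once and twice. The velocities are \<open>A v\<close> and \<open>A (A v)\<close>; the first image
  is a curve in \<open>X\<close>, and the second is the original curve.\<close>

lemma A_tangent:
  assumes "v \<in> T"
  shows "A v \<in> T" "A (A v) = v"
proof -
  have "\<phi> p \<in> \<phi> ` U" using p(1) by blast
  then obtain e V \<Gamma> where e: "e > 0" "open V" "holomorphic_map V \<Gamma>" "\<Gamma> 0 = \<phi> p"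
    "\<And>t. t \<in> {-e<..<e} \<Longrightarrow> of_real t *s v \<in> V" "\<And>t. t \<in> {-e<..<e} \<Longrightarrow> \<Gamma> (of_real t *s v) \<in> \<phi> ` U"
    "((\<lambda>t. \<Gamma> (of_real t *s v)) has_vector_derivative v) (at 0)"
    by (rule tangent_curve[OF P _ assms]) blast
  define \<gamma> where "\<gamma> t = inv_into U \<phi> (\<Gamma> (of_real t *s v))" for t :: real
  have \<gamma>: "\<gamma> t \<in> U" "\<phi> (\<gamma> t) = \<Gamma> (of_real t *s v)" if "t \<in> {-e<..<e}" for t
    using e(6)[OF that] by (auto simp: \<gamma>_def inv_into_into f_inv_into_f)
  have \<gamma>0: "\<gamma> 0 = p" using e(4) inv_into_chart[OF alg U p(1)] by (simp add: \<gamma>_def)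
  have der: "((\<lambda>t. \<phi> (\<gamma> t)) has_vector_derivative v) (at 0)"
    by (rule has_vector_derivative_transform_within_open[OF e(7), of "{-e<..<e}"]) (use e(1) \<gamma> in auto)
  obtain d1 where d1: "d1 > 0" "d1 \<le> e" "\<And>t. t \<in> {-d1<..<d1} \<Longrightarrow> invol X (\<gamma> t) \<in> U"
    "((\<lambda>t. \<phi> (invol X (\<gamma> t))) has_vector_derivative A v) (at (0::real))"
    using velocity_invol[OF der \<gamma>0 e(1) \<gamma>(1)] by blast
  have "A v \<in> zariski_tangent (\<phi> ` U) (\<phi> (invol X (\<gamma> 0)))"
    by (rule velocity_in_zariski_tangent[OF d1(4,1)]) (use d1(3) in auto)
  then show "A v \<in> T" using \<gamma>0 p by simp
  have "invol X (\<gamma> 0) = p" using \<gamma>0 p by simp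
  then obtain d2 where d2: "d2 > 0" "d2 \<le> d1"
    "((\<lambda>t. \<phi> (invol X (invol X (\<gamma> t)))) has_vector_derivative A (A v)) (at (0::real))"
    using velocity_invol[of "\<lambda>t. invol X (\<gamma> t)", OF d1(4) _ d1(1,3)] by blast
  have "((\<lambda>t. \<phi> (invol X (invol X (\<gamma> t)))) has_vector_derivative v) (at 0)"
    by (rule has_vector_derivative_transform_within_open[OF der, of "{-e<..<e}"])
      (use e(1) \<gamma>(1) invol_invol in auto)
  with d2(3) show "A (A v) = v" by (rule vector_derivative_unique_at)
qed

text \<open>The chart \<open>x \<mapsto> (\<pi> x + A (\<pi> (invol x))) / 2\<close>, with \<open>\<pi>\<close> the projection to the tangent space at
  \<open>p\<close>, turns the involution into the linear map \<open>A\<close>.\<close>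

lemma linearizing_chart:
  obtains W \<psi> F where "smooth_chart X W \<psi> T" "p \<in> W" "subspace F" "F \<subseteq> T" "dim F = d"
    "\<psi> ` (real_points X (points X) \<inter> W) = \<psi> ` W \<inter> F"
proof -
  let ?z = "\<phi> p"
  note PT = local_equationD(1-4)[OF P] and R = local_equationD(5-8)[OF P]
  obtain N where N: "open N" "?z \<in> N" "\<And>z. z \<in> N \<Longrightarrow> z \<in> \<phi> ` U \<longleftrightarrow> R z = 0"
    using local_equation_neighbourhood[OF P] by blast
  \<comment> \<open>The conjugated half of the average: \<open>B (G z - vcnj ?z)\<close> equals
    \<open>(1/2) *s A (P (vcnj (G z) - ?z))\<close>. The two conjugations hidden in \<open>A\<close>
    and \<open>vcnj\<close> cancel, so \<open>B\<close> is complex linear and \<open>\<Phi>\<close>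
    remains holomorphic.\<close>
  define B where "B v = (1/2) *s A (P (vcnj v))" for v
  have half: "linear (\<lambda>v :: complex ^ 'n. (1/2) *s v)"
    using bounded_linear_smult_right linear_conv_bounded_linear by blast
  have "B = (\<lambda>v. (1/2) *s v) \<circ> (A \<circ> (P \<circ> vcnj))" by (simp add: B_def fun_eq_iff)
  then have B: "linear B" by (simp only: linear_compose half linear_A PT(1) linear_vcnj)
  have Bs: "B (a *s v) = a *s B v" for a v
    by (simp add: B_def vcnj_simps PT(2) A_smult vec.scale_left_commute)
  define Q where "Q v = (1/2) *s P v" for v
  have "Q = (\<lambda>v. (1/2) *s v) \<circ> P" by (simp add: Q_def fun_eq_iff)
  then have Q: "linear Q" by (simp only: linear_compose half PT(1))
  have Qs: "Q (a *s v) = a *s Q v" for a v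
    by (simp add: Q_def PT(2) vec.scale_left_commute)
  define K where "K z = Q (z - ?z) + B (G z - vcnj ?z)" for z
  have BT: "B v \<in> T" and QT: "Q v \<in> T" for v
    unfolding B_def Q_def
    using zariski_tangent_closed(4)[OF A_tangent(1)[OF PT(3)]] zariski_tangent_closed(4)[OF PT(3)] by blast+
  have KT: "K z \<in> T" for z unfolding K_def by (rule zariski_tangent_closed(2)[OF QT BT])
  define \<Phi> where "\<Phi> z = R z + K z" for z
  have hol: "holomorphic_map (S \<inter> N) \<Phi>"
    unfolding \<Phi>_def K_def
    by (intro holomorphic_map_add holomorphic_map_linear Q Qs
        holomorphic_map_compose[OF holomorphic_map_subset[OF G] holomorphic_map_linear(1)[OF B Bs, of UNIV]]
        holomorphic_map_subset[OF R(1)]) auto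
  define D where "D v = (v - P v) + (Q v + B (L v))" for v
  have der: "(\<Phi> has_derivative D) (at ?z)"
    unfolding \<Phi>_def K_def D_def
    by (intro has_derivative_add R(2) holomorphic_map_linear(2) Q Qs
        has_derivative_compose[OF L(1) holomorphic_map_linear(2)[OF B Bs]])
  have vcnj_vcnj: "vcnj (vcnj v) = v" for v :: "complex ^ 'n" by (simp add: vcnj_def vec_eq_iff)
  have BL: "B (L v) = (1/2) *s A (P (A v))" for v by (simp add: B_def A_def)
  \<comment> \<open>\<open>D\<close> is the identity on \<open>T\<close>, where both halves of the
    average equal \<open>(1/2) *s v\<close>. A vector annihilated by \<open>D\<close> lies in
    \<open>T\<close>, as one sees by applying \<open>P\<close>.\<close>
  have injD: "inj D"
  proof -
    have "v = 0" if "D v = 0" for v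
    proof -
      have "P (D v) = Q v + B (L v)"
        unfolding D_def linear_add[OF PT(1)] linear_diff[OF PT(1)] PT(4)[OF PT(3)]
          PT(4)[OF QT] PT(4)[OF BT] by simp
      then have 0: "Q v + B (L v) = 0" using that linear_0[OF PT(1)] by simp
      with that have "P v = v" by (simp add: D_def)
      then have "v \<in> T" using PT(3) by metis
      then have "Q v + B (L v) = v"
        unfolding BL Q_def PT(4)[OF A_tangent(1)[OF \<open>v \<in> T\<close>]] A_tangent(2)[OF \<open>v \<in> T\<close>] \<open>P v = v\<close>
        by (simp add: vec_eq_iff)
      with 0 show "v = 0" by simp
    qed
    then show ?thesis using linear_injective_0[OF has_derivative_linear[OF der]] by blast
  qed
  obtain D1 D2 \<Gamma> where D1: "open D1" "?z \<in> D1" "D1 \<subseteq> S \<inter> N" "open D2" "homeomorphism D1 D2 \<Phi> \<Gamma>"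
    "holomorphic_map D2 \<Gamma>"
    by (rule holomorphic_inverse_function[OF _ hol _ der injD]) (use S N in auto)
  \<comment> \<open>Intersecting with the preimage under the involution makes the chart domain
    \<open>W\<close> invariant, since the involution applied twice returns to the starting point in
    \<open>D1\<close>.\<close>
  define E where "E = D1 \<inter> (\<lambda>z. vcnj (G z)) -` D1"
  have "continuous_on D1 G"
    by (rule continuous_on_subset[OF holomorphic_map_continuous_on[OF G]]) (use D1(3) in blast)
  moreover have "continuous_on UNIV (vcnj :: complex ^ 'n \<Rightarrow> _)"
    by (rule linear_continuous_on[OF linear_vcnj[unfolded linear_conv_bounded_linear]])
  ultimately have "continuous_on D1 (\<lambda>z. vcnj (G z))"
    using continuous_on_compose2 by (metis subset_UNIV)
  from continuous_open_preimage[OF this D1(1) D1(1)] have E: "open E" "E \<subseteq> D1"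
    unfolding E_def by simp_all
  note r = homeomorphism_open_restrict[OF D1(5,1,4) E]
  have \<sigma>z: "vcnj (G ?z) = ?z" using G_eq[OF p(1) S(2)] p(2) by simp
  define W where "W = {x \<in> U. \<phi> x \<in> E}"
  let ?\<psi> = "\<Phi> \<circ> \<phi>"
  have chart: "smooth_chart X W ?\<psi> T"
    unfolding W_def
  proof (rule smooth_chart_of_straightening[OF alg U E(1) r(2,1) _ _ subspace_zariski_tangent])
    show "holomorphic_map E \<Phi>" by (rule holomorphic_map_subset[OF hol]) (use E(2) D1(3) in blast)
    show "holomorphic_map (\<Phi> ` E) \<Gamma>" by (rule holomorphic_map_subset[OF D1(6) r(3)])
    fix z assume z: "z \<in> E"
    show "z \<in> \<phi> ` U \<longleftrightarrow> \<Phi> z \<in> T"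
    proof
      assume "\<Phi> z \<in> T"
      then have "P (\<Phi> z) = \<Phi> z" by (rule PT(4))
      moreover have "P (\<Phi> z) = K z"
        unfolding \<Phi>_def linear_add[OF PT(1)] R(3) PT(4)[OF KT] by simp
      ultimately have "R z = 0" by (simp add: \<Phi>_def)
      then show "z \<in> \<phi> ` U" using N(3) z E(2) D1(3) by blast
    qed (use R(4) KT in \<open>auto simp: \<Phi>_def\<close>)
  qed
  then have inj: "inj_on ?\<psi> W" by (simp add: smooth_chart_def)
  let ?F = "{v \<in> T. A v = v}"
  have F: "subspace ?F" "dim ?F = d"
    using dim_fixed_points_antilinear[OF subspace_zariski_tangent zariski_tangent_closed(4)
        linear_A A_smult A_tangent] dim by auto
  have \<sigma>: "invol X x \<in> W" "?\<psi> (invol X x) = A (?\<psi> x)" "?\<psi> x \<in> T" if "x \<in> W" for x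
  proof -
    have x: "x \<in> U" "\<phi> x \<in> D1" "vcnj (G (\<phi> x)) \<in> D1" using that by (auto simp: W_def E_def)
    then have \<sigma>x: "invol X x \<in> U" "\<phi> (invol X x) = vcnj (G (\<phi> x))" using G_eq D1(3) by blast+
    then have "\<phi> (invol X x) \<in> S" using x(3) D1(3) by auto
    then have \<sigma>\<sigma>x: "\<phi> x = vcnj (G (\<phi> (invol X x)))"
      using G_eq[OF \<sigma>x(1)] invol_invol[OF x(1)] by simp
    then show "invol X x \<in> W" using x \<sigma>x by (simp add: W_def E_def)
    have \<psi>: "?\<psi> y = (1/2) *s (P (\<phi> y - ?z) + A (P (vcnj (G (\<phi> y)) - ?z)))" if "y \<in> U" for y
      using that R(4)
      by (simp add: linear_diff[OF linear_vcnj] \<Phi>_def K_def Q_def B_def vcnj_vcnj vec.scale_right_distrib)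
    show "?\<psi> (invol X x) = A (?\<psi> x)"
      unfolding \<psi>[OF x(1)] \<psi>[OF \<sigma>x(1)] \<sigma>x(2)[symmetric] \<sigma>\<sigma>x[symmetric] A_smult
        linear_add[OF linear_A] A_tangent(2)[OF PT(3)] by (simp add: add.commute)
    show "?\<psi> x \<in> T" using x(1) R(4) KT by (simp add: \<Phi>_def)
  qed
  \<comment> \<open>Both \<open>x\<close> and its conjugate lie in \<open>W\<close>, where
    \<open>?\<psi>\<close> is injective, so they coincide exactly if their coordinates
    \<open>?\<psi> x\<close> and \<open>A (?\<psi> x)\<close> do.\<close>
  have "invol X x = x \<longleftrightarrow> ?\<psi> x \<in> ?F" if "x \<in> W" for x
    using \<sigma>[OF that] that inj by (metis (mono_tags, lifting) inj_onD mem_Collect_eq)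
  moreover have "W \<subseteq> points X" using atlasD(3)[OF alg U] by (auto simp: W_def)
  ultimately have "?\<psi> ` (real_points X (points X) \<inter> W) = ?\<psi> ` W \<inter> ?F"
    unfolding real_points_def by blast
  moreover have "p \<in> W" using p(1) D1(2) \<sigma>z by (simp add: W_def E_def)
  ultimately show ?thesis using that[OF chart _ F(1) _ F(2)] by blast
qed

end

section \<open>Transversality\<close>

text \<open>\<open>smooth_curve\<close> asks for smoothness in every atlas chart that the curve
  meets. In such a chart it is, locally, a transition map composed with \<open>\<Gamma>\<close> on a
  real line, hence holomorphic along a line.\<close>

lemma smooth_curve_holomorphic:
  assumes X: "algebraic_variety X" "(U, \<phi>) \<in> atlas X"
    and V: "open V" "holomorphic_map V \<Gamma>"
    and tV: "\<And>t. t \<in> {-e<..<e} \<Longrightarrow> of_real t *s v \<in> V"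
    and tU: "\<And>t. t \<in> {-e<..<e} \<Longrightarrow> \<Gamma> (of_real t *s v) \<in> \<phi> ` U"
  shows "smooth_curve X e (\<lambda>t. inv_into U \<phi> (\<Gamma> (of_real t *s v)))"
  unfolding smooth_curve_def
proof (rule ballI, rule conjI)
  let ?\<gamma> = "\<lambda>t. inv_into U \<phi> (\<Gamma> (of_real t *s v))"
  have \<gamma>: "?\<gamma> t \<in> U" "\<phi> (?\<gamma> t) = \<Gamma> (of_real t *s v)" if "t \<in> {-e<..<e}" for t
    using tU[OF that] by (auto simp: inv_into_into f_inv_into_f)
  fix t0 assume t0: "t0 \<in> {-e<..<e}"
  show "?\<gamma> t0 \<in> points X" using \<gamma>(1)[OF t0] atlasD(3)[OF X] by blast
  show "\<forall>(W, \<psi>)\<in>atlas X. ?\<gamma> t0 \<in> W \<longrightarrow>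
      (\<exists>d>0. ?\<gamma> ` {t0-d<..<t0+d} \<subseteq> W \<and> smooth_on {t0-d<..<t0+d} (\<psi> \<circ> ?\<gamma>))"
  proof clarify
    fix W \<psi> assume W: "(W, \<psi>) \<in> atlas X" and "?\<gamma> t0 \<in> W"
    then have "\<Gamma> (of_real t0 *s v) \<in> \<phi> ` (U \<inter> W)" using \<gamma>[OF t0] by (metis IntI image_eqI)
    then obtain S H where S: "open S" "\<Gamma> (of_real t0 *s v) \<in> S" "holomorphic_map S H"
      "\<forall>z\<in>\<phi> ` (U \<inter> W) \<inter> S. \<psi> (inv_into U \<phi> z) = H z"
      using hol_within_transition[OF X W] unfolding hol_within_def by blast
    obtain Q where Q: "open Q" "\<phi> ` (U \<inter> W) = \<phi> ` U \<inter> Q" "\<And>x. x \<in> U \<Longrightarrow> \<phi> x \<in> Q \<longleftrightarrow> x \<in> W"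
      using open_domain_of_transition[OF X W] by blast
    let ?V = "V \<inter> \<Gamma> -` (S \<inter> Q)"
    have "open ?V"
      using continuous_open_preimage[OF holomorphic_map_continuous_on[OF V(2)] V(1), of "S \<inter> Q"] S(1) Q(1) by auto
    let ?I = "{-e<..<e} \<inter> (\<lambda>t. of_real t *s v) -` ?V"
    have "open ((\<lambda>t :: real. of_real t *s v) -` ?V)"
      by (rule open_vimage[OF \<open>open ?V\<close>])
        (intro bounded_linear.continuous_on[OF bounded_linear_smult_left] continuous_intros)
    then have "open ?I" by auto
    moreover have "t0 \<in> ?I"
      using t0 tV[OF t0] S(2) Q(2) \<open>\<Gamma> (of_real t0 *s v) \<in> \<phi> ` (U \<inter> W)\<close> by auto
    ultimately obtain d where d: "d > 0" "ball t0 d \<subseteq> ?I" using open_contains_ball by blast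
    have "ball t0 d = {t0-d<..<t0+d}" by (simp add: ball_eq_greaterThanLessThan)
    with d(2) have I: "{t0-d<..<t0+d} \<subseteq> ?I" by simp
    have inW: "?\<gamma> t \<in> W" if "t \<in> {t0-d<..<t0+d}" for t
      using subsetD[OF I that] \<gamma>[of t] Q(3)[of "?\<gamma> t"] by auto
    have eq: "\<psi> (?\<gamma> t) = H (\<Gamma> (of_real t *s v))" if "t \<in> {t0-d<..<t0+d}" for t
      using subsetD[OF I that] tU[of t] S(4) Q(2) by auto
    have hol: "holomorphic_map ?V (\<lambda>z. H (\<Gamma> z))"
      by (rule holomorphic_map_compose[OF holomorphic_map_subset[OF V(2)] S(3)]) auto
    have "Ck_on k {t0-d<..<t0+d} (\<psi> \<circ> ?\<gamma>)" for k
    \<comment> \<open>The \<open>0 +\<close> supplies the base point of the line in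
      \<open>Ck_on_holomorphic_along_line\<close>.\<close>
    proof (rule Ck_on_cong[where f = "\<lambda>t. H (\<Gamma> (0 + of_real t *s v))"])
      show "Ck_on k {t0-d<..<t0+d} (\<lambda>t. H (\<Gamma> (0 + of_real t *s v)))"
        by (rule Ck_on_holomorphic_along_line[OF \<open>open ?V\<close> _ hol]) (use I in auto)
    qed (use eq in auto)
    then show "\<exists>d>0. ?\<gamma> ` {t0-d<..<t0+d} \<subseteq> W \<and> smooth_on {t0-d<..<t0+d} (\<psi> \<circ> ?\<gamma>)"
      using d(1) inW unfolding smooth_on_def by blast
  qed
qed

text \<open>\<open>velocity\<close> has the default value 0 on functions that are not smooth at
  \<open>p\<close>, so linear coordinates can serve as test functions only once this is
  known.\<close>

lemma smooth_function_coordinate: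
  fixes l :: "complex ^ 'n \<Rightarrow> real"
  assumes X: "algebraic_variety X" "(U, \<phi>) \<in> atlas X" and "p \<in> U" and l: "bounded_linear l"
  shows "smooth_function_at X p (\<lambda>x. l (\<phi> x))"
  unfolding smooth_function_at_def
proof clarify
  fix V \<psi> assume V: "(V, \<psi>) \<in> atlas X" and "p \<in> V"
  then have "\<psi> p \<in> \<psi> ` (V \<inter> U)" using \<open>p \<in> U\<close> by blast
  then obtain S H where S: "open S" "\<psi> p \<in> S" "holomorphic_map S H"
    "\<forall>z\<in>\<psi> ` (V \<inter> U) \<inter> S. \<phi> (inv_into V \<psi> z) = H z"
    using hol_within_transition[OF X(1) V X(2)] unfolding hol_within_def by blast
  obtain Q where Q: "open Q" "\<psi> ` (V \<inter> U) = \<psi> ` V \<inter> Q" "\<And>x. x \<in> V \<Longrightarrow> \<psi> x \<in> Q \<longleftrightarrow> x \<in> U"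
    using open_domain_of_transition[OF X(1) V X(2)] by blast
  have op: "open (S \<inter> Q)" using S(1) Q(1) by blast
  have "smooth_on (S \<inter> Q) (\<lambda>z. l (H z))"
    unfolding smooth_on_def
    by (intro allI Ck_on_bounded_linear[OF _ l] Ck_on_holomorphic_map[OF op] holomorphic_map_subset[OF S(3)]) auto
  moreover have "l (\<phi> x) = l (H (\<psi> x))" if "x \<in> V" "\<psi> x \<in> S \<inter> Q" for x
  proof -
    have "\<psi> x \<in> \<psi> ` (V \<inter> U) \<inter> S" using that Q(2) by blast
    then have "\<phi> (inv_into V \<psi> (\<psi> x)) = H (\<psi> x)" using S(4) by blast
    then show ?thesis using inv_into_chart[OF X(1) V that(1)] by simp
  qed
  moreover have "\<psi> p \<in> S \<inter> Q" using S(2) Q(3)[OF \<open>p \<in> V\<close>] \<open>p \<in> U\<close> by blast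
  ultimately show "\<exists>S F. open S \<and> \<psi> p \<in> S \<and> smooth_on S F \<and> (\<forall>x\<in>V. \<psi> x \<in> S \<longrightarrow> l (\<phi> x) = F (\<psi> x))"
    using op by (intro exI[of _ "S \<inter> Q"] exI[of _ "\<lambda>z. l (H z)"]) blast
qed

text \<open>Links the two descriptions of a tangent vector: the derivation
  \<open>velocity X p \<gamma>\<close>, tested on linear coordinates, returns the coordinates of the
  derivative \<open>w\<close> of the curve in the chart.\<close>

lemma velocity_in_chart:
  assumes X: "algebraic_variety X" "(U, \<phi>) \<in> atlas X" and \<gamma>: "smooth_curve X e \<gamma>" "e > 0" "\<gamma> 0 = p" "p \<in> U"
  obtains w d where "d > 0" "\<And>t. t \<in> {-d<..<d} \<Longrightarrow> \<gamma> t \<in> U"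
    "((\<lambda>t. \<phi> (\<gamma> t)) has_vector_derivative w) (at 0)"
    "\<And>l. bounded_linear l \<Longrightarrow> velocity X p \<gamma> (\<lambda>x. l (\<phi> x)) = l w"
proof -
  have "(0::real) \<in> {-e<..<e}" using \<gamma>(2) by simp
  then have "\<forall>(U, \<phi>)\<in>atlas X. \<gamma> 0 \<in> U \<longrightarrow>
      (\<exists>d>0. \<gamma> ` {0-d<..<0+d} \<subseteq> U \<and> smooth_on {0-d<..<0+d} (\<phi> \<circ> \<gamma>))"
    using \<gamma>(1) unfolding smooth_curve_def by blast
  from bspec[OF this X(2)] have "\<exists>d>0. \<gamma> ` {0-d<..<0+d} \<subseteq> U \<and> smooth_on {0-d<..<0+d} (\<phi> \<circ> \<gamma>)"
    using \<gamma>(3,4) by simp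
  then obtain d where d: "d > 0" "\<gamma> ` {-d<..<d} \<subseteq> U" "smooth_on {-d<..<d} (\<phi> \<circ> \<gamma>)" by auto
  have "Ck_on (Suc 0) {-d<..<d} (\<phi> \<circ> \<gamma>)" using d(3) unfolding smooth_on_def by blast
  then obtain f' where f': "\<forall>x\<in>{-d<..<d}. (\<phi> \<circ> \<gamma> has_derivative f' x) (at x)" by auto
  define w where "w = f' 0 1"
  have "(\<phi> \<circ> \<gamma> has_derivative f' 0) (at 0)" using f' d(1) by simp
  moreover have "f' 0 = (\<lambda>s. s *\<^sub>R w)"
  proof
    fix s :: real
    show "f' 0 s = s *\<^sub>R w"
      using linear_scale[OF has_derivative_linear[OF \<open>(\<phi> \<circ> \<gamma> has_derivative f' 0) (at 0)\<close>], of s 1]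
      by (simp add: w_def)
  qed
  ultimately have w: "((\<lambda>t. \<phi> (\<gamma> t)) has_vector_derivative w) (at 0)"
    by (simp add: has_vector_derivative_def o_def)
  have "velocity X p \<gamma> (\<lambda>x. l (\<phi> x)) = l w" if l: "bounded_linear l" for l
  proof -
    have "((\<lambda>t. l (\<phi> (\<gamma> t))) has_vector_derivative l w) (at 0)"
      by (rule bounded_linear.has_vector_derivative[OF l w])
    then have "deriv ((\<lambda>x. l (\<phi> x)) \<circ> \<gamma>) 0 = l w"
      by (simp add: has_real_derivative_iff_has_vector_derivative[symmetric] o_def DERIV_imp_deriv)
    then show ?thesis
      using smooth_function_coordinate[OF X \<gamma>(4) l] by (simp add: velocity_def)
  qed
  then show ?thesis using that d(1,2) w by blast
qed

section \<open>Tangent spaces at a transverse real point\<close>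

context nonsingular_real_structure_chart
begin

text \<open>Transversality splits the derivation of a curve with velocity \<open>v\<close> into
  those of a curve in \<open>Y\<close> and a curve of real points. The involution maps the first
  curve into \<open>Y\<close> again, so both \<open>w1\<close> and \<open>A w1\<close> are tangent
  to \<open>Y\<close>; it fixes the second pointwise, so \<open>A w2 = w2\<close>.\<close>

lemma tangent_subset_of_transverse:
  assumes Y: "Y \<subseteq> points X" "invol X ` Y \<subseteq> Y" "p \<in> Y"
    and tr: "transverse X Y (real_points X (points X))"
  shows "T \<subseteq> zariski_tangent (\<phi> ` (Y \<inter> U)) (\<phi> p)"
proof
  let ?TY = "zariski_tangent (\<phi> ` (Y \<inter> U)) (\<phi> p)"
  let ?RX = "real_points X (points X)"
  have pU: "\<phi> p \<in> \<phi> ` U" using p(1) by blast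
  have pR: "p \<in> Y \<inter> ?RX" using Y p by (auto simp: real_points_def)
  have minus: "v - A v \<in> ?TY" if v: "v \<in> T" for v
  proof -
    obtain e V \<Gamma> where e: "e > 0" "open V" "holomorphic_map V \<Gamma>" "\<Gamma> 0 = \<phi> p"
      "\<And>t. t \<in> {-e<..<e} \<Longrightarrow> of_real t *s v \<in> V" "\<And>t. t \<in> {-e<..<e} \<Longrightarrow> \<Gamma> (of_real t *s v) \<in> \<phi> ` U"
      "((\<lambda>t. \<Gamma> (of_real t *s v)) has_vector_derivative v) (at 0)"
      by (rule tangent_curve[OF P pU v]) blast
    define \<gamma> where "\<gamma> t = inv_into U \<phi> (\<Gamma> (of_real t *s v))" for t :: real
    have sm: "smooth_curve X e \<gamma>"
      unfolding \<gamma>_def by (rule smooth_curve_holomorphic[OF alg U e(2,3,5,6)])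
    have \<gamma>0: "\<gamma> 0 = p" using e(4) inv_into_chart[OF alg U p(1)] by (simp add: \<gamma>_def)
    obtain w d where w: "d > 0" "\<And>t. t \<in> {-d<..<d} \<Longrightarrow> \<gamma> t \<in> U"
      "((\<lambda>t. \<phi> (\<gamma> t)) has_vector_derivative w) (at 0)"
      "\<And>l. bounded_linear l \<Longrightarrow> velocity X p \<gamma> (\<lambda>x. l (\<phi> x)) = l w"
      by (rule velocity_in_chart[OF alg U sm e(1) \<gamma>0 p(1)]) blast
    have "((\<lambda>t. \<Gamma> (of_real t *s v)) has_vector_derivative w) (at 0)"
      by (rule has_vector_derivative_transform_within_open[OF w(3), of "{-e<..<e}"])
        (use e(1,6) in \<open>auto simp: \<gamma>_def f_inv_into_f\<close>)
    then have "w = v" using e(7) by (rule vector_derivative_unique_at)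
    have "velocity X p \<gamma> \<in> tangent_space X (points X) p"
      using e(1) sm \<gamma>0 unfolding tangent_space_def smooth_curve_def by blast
    then have "velocity X p \<gamma> \<in> {(\<lambda>f. v f + w f) | v w. v \<in> tangent_space X Y p \<and> w \<in> tangent_space X ?RX p}"
      using tr pR unfolding transverse_def by blast
    then obtain \<gamma>1 e1 \<gamma>2 e2 where vel: "velocity X p \<gamma> = (\<lambda>f. velocity X p \<gamma>1 f + velocity X p \<gamma>2 f)"
      and 1: "e1 > 0" "smooth_curve X e1 \<gamma>1" "\<gamma>1 0 = p" "\<gamma>1 ` {-e1<..<e1} \<subseteq> Y"
      and 2: "e2 > 0" "smooth_curve X e2 \<gamma>2" "\<gamma>2 0 = p" "\<gamma>2 ` {-e2<..<e2} \<subseteq> ?RX"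
      unfolding tangent_space_def by blast
    obtain w1 d1 where w1: "d1 > 0" "\<And>t. t \<in> {-d1<..<d1} \<Longrightarrow> \<gamma>1 t \<in> U"
      "((\<lambda>t. \<phi> (\<gamma>1 t)) has_vector_derivative w1) (at 0)"
      "\<And>l. bounded_linear l \<Longrightarrow> velocity X p \<gamma>1 (\<lambda>x. l (\<phi> x)) = l w1"
      by (rule velocity_in_chart[OF alg U 1(2,1,3) p(1)]) blast
    obtain w2 d2 where w2: "d2 > 0" "\<And>t. t \<in> {-d2<..<d2} \<Longrightarrow> \<gamma>2 t \<in> U"
      "((\<lambda>t. \<phi> (\<gamma>2 t)) has_vector_derivative w2) (at 0)"
      "\<And>l. bounded_linear l \<Longrightarrow> velocity X p \<gamma>2 (\<lambda>x. l (\<phi> x)) = l w2"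
      by (rule velocity_in_chart[OF alg U 2(2,1,3) p(1)]) blast
    \<comment> \<open>The derivations agree on all functions; evaluating them on
      \<open>\<phi> x \<bullet> b\<close> for every \<open>b\<close> turns their sum into a sum of
      vectors.\<close>
    have "v \<bullet> b = (w1 + w2) \<bullet> b" for b
      using fun_cong[OF vel, of "\<lambda>x. \<phi> x \<bullet> b"] w(4)[OF bounded_linear_inner_left, of b] \<open>w = v\<close>
        w1(4)[OF bounded_linear_inner_left, of b] w2(4)[OF bounded_linear_inner_left, of b]
      by (simp add: inner_add_left)
    then have v12: "v = w1 + w2" using vector_eq_rdot by blast
    have "w1 \<in> zariski_tangent (\<phi> ` (Y \<inter> U)) (\<phi> (\<gamma>1 0))"
      by (rule velocity_in_zariski_tangent[OF w1(3), of "min d1 e1"]) (use w1(1,2) 1(1,4) in \<open>auto simp: min_def image_subset_iff split: if_splits\<close>)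
    then have TY1: "w1 \<in> ?TY" using 1(3) by simp
    obtain d3 where d3: "d3 > 0" "d3 \<le> d1" "\<And>t. t \<in> {-d3<..<d3} \<Longrightarrow> invol X (\<gamma>1 t) \<in> U"
      "((\<lambda>t. \<phi> (invol X (\<gamma>1 t))) has_vector_derivative A w1) (at (0::real))"
      using velocity_invol[OF w1(3) 1(3) w1(1,2)] by blast
    have "A w1 \<in> zariski_tangent (\<phi> ` (Y \<inter> U)) (\<phi> (invol X (\<gamma>1 0)))"
      by (rule velocity_in_zariski_tangent[OF d3(4), of "min d3 e1"]) (use d3(1,3) 1(1,4) Y(2) in \<open>auto simp: min_def image_subset_iff split: if_splits\<close>)
    then have TY2: "A w1 \<in> ?TY" using 1(3) p by simp
    obtain d4 where d4: "d4 > 0" "d4 \<le> d2"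
      "((\<lambda>t. \<phi> (invol X (\<gamma>2 t))) has_vector_derivative A w2) (at (0::real))"
      using velocity_invol[OF w2(3) 2(3) w2(1,2)] by blast
    have "((\<lambda>t. \<phi> (invol X (\<gamma>2 t))) has_vector_derivative w2) (at 0)"
      by (rule has_vector_derivative_transform_within_open[OF w2(3), of "{-e2<..<e2}"])
        (use 2(1,4) in \<open>auto simp: real_points_def image_subset_iff\<close>)
    with d4(3) have "A w2 = w2" by (rule vector_derivative_unique_at)
    then have "v - A v = w1 - A w1" using v12 linear_add[OF linear_A] by simp
    then show ?thesis using zariski_tangent_closed(3)[OF TY1 TY2] by simp
  qed
  fix v assume v: "v \<in> T"
  have "\<i> *s v - A (\<i> *s v) \<in> ?TY" by (rule minus[OF zariski_tangent_closed(4)[OF v]])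
  \<comment> \<open>The factor \<open>- \<i>\<close> turns \<open>\<i> *s (v + A v)\<close> into
    \<open>v + A v\<close>.\<close>
  then have "(- \<i>) *s (\<i> *s v - A (\<i> *s v)) \<in> ?TY" by (rule zariski_tangent_closed(4))
  from zariski_tangent_closed(4)[OF zariski_tangent_closed(2)[OF minus[OF v] this], of "1/2"]
  have "(1/2) *s ((v - A v) + (- \<i>) *s (\<i> *s v - A (\<i> *s v))) \<in> ?TY" .
  moreover have "(1/2) *s ((v - A v) + (- \<i>) *s (\<i> *s v - A (\<i> *s v))) = v"
    unfolding A_smult by (simp add: vec_eq_iff algebra_simps)
  ultimately show "v \<in> ?TY" by simp
qed

end

lemma real_structure_chart_exists:
  assumes X: "real_algebraic_variety X" "nonsingular_of_dim X (points X) d"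
    and p: "p \<in> real_points X (points X)"
  obtains U \<phi> S G L P R where "(U, \<phi>) \<in> atlas X" "p \<in> U" "nonsingular_real_structure_chart X U \<phi> p S G L P R d"
proof -
  have alg: "algebraic_variety X" and anti: "antiholomorphic X (invol X)"
    using X(1) by (simp_all add: real_algebraic_variety_def)
  have p': "p \<in> points X" "invol X p = p" using p by (auto simp: real_points_def)
  obtain U \<phi> where U: "(U, \<phi>) \<in> atlas X" "p \<in> U" using atlas_covers[OF alg p'(1)] by blast
  have XU: "points X \<inter> U = U" using atlasD(3)[OF alg U(1)] by blast
  from bspec[OF anti[unfolded antiholomorphic_def] U(1)]
  have "\<forall>(V, \<psi>)\<in>atlas X. \<forall>p\<in>U. invol X p \<in> V \<longrightarrow> (\<exists>S G. open S \<and> \<phi> p \<in> S \<and> holomorphic_map S G \<and>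
           (\<forall>x\<in>U. \<phi> x \<in> S \<longrightarrow> invol X x \<in> V \<and> \<psi> (invol X x) = (\<chi> j. cnj (G (\<phi> x) $ j))))"
    by simp
  from bspec[OF this U(1)]
  have "\<exists>S G. open S \<and> \<phi> p \<in> S \<and> holomorphic_map S G \<and>
           (\<forall>x\<in>U. \<phi> x \<in> S \<longrightarrow> invol X x \<in> U \<and> \<phi> (invol X x) = vcnj (G (\<phi> x)))"
    using U(2) p'(2) by (simp add: vcnj_def)
  then obtain S G where S: "open S" "\<phi> p \<in> S" "holomorphic_map S G"
      "\<forall>x\<in>U. \<phi> x \<in> S \<longrightarrow> invol X x \<in> U \<and> \<phi> (invol X x) = vcnj (G (\<phi> x))" by blast
  obtain L where L: "(G has_derivative L) (at (\<phi> p))" "\<And>a v. L (a *s v) = a *s L v"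
    using S(2,3) unfolding holomorphic_map_def by blast
  obtain P R where PR: "local_equation (\<phi> ` U) (\<phi> p) P R" "dim (zariski_tangent (\<phi> ` U) (\<phi> p)) = 2 * d"
    using local_equation_subvariety[OF alg U(1) subvariety_points[OF alg] X(2), of p, unfolded XU, OF U(2)]
    by metis
  have "nonsingular_real_structure_chart X U \<phi> p S G L P R d"
    by unfold_locales (use X(1) U p'(2) S L PR in simp_all)
  then show ?thesis using that U by blast
qed

section \<open>Real points as a submanifold, and the conclusion\<close>

lemma smooth_submanifold_real_points:
  assumes "real_algebraic_variety X" "nonsingular_of_dim X (points X) d"
  shows "smooth_submanifold X (real_points X (points X))"
  unfolding smooth_submanifold_def
\<comment> \<open>The fixed space of the involution has half of the real dimension
  \<open>2 * d\<close> of the tangent space.\<close>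
proof (intro conjI exI[of _ d] ballI)
  show "real_points X (points X) \<subseteq> points X" by (auto simp: real_points_def)
  fix p assume "p \<in> real_points X (points X)"
  then obtain U \<phi> S G L P R where "nonsingular_real_structure_chart X U \<phi> p S G L P R d"
    using real_structure_chart_exists[OF assms] by metis
  then interpret nonsingular_real_structure_chart X U \<phi> p S G L P R d .
  obtain W \<psi> F where "smooth_chart X W \<psi> T" "p \<in> W" "subspace F" "F \<subseteq> T" "dim F = d"
    "\<psi> ` (real_points X (points X) \<inter> W) = \<psi> ` W \<inter> F"
    by (rule linearizing_chart)
  then show "\<exists>W \<psi> E F. smooth_chart X W \<psi> E \<and> p \<in> W \<and> subspace F \<and> F \<subseteq> E \<and> dim F = d \<and>
      \<psi> ` (real_points X (points X) \<inter> W) = \<psi> ` W \<inter> F"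
    by (intro exI[of _ W] exI[of _ \<psi>] exI[of _ T] exI[of _ F]) simp
qed

text \<open>A single common point is enough: there the two tangent spaces coincide, and their real
  dimensions are \<open>2 * dimY\<close> and \<open>2 * dimX\<close>.\<close>

lemma dim_eq_of_transverse:
  assumes X: "real_algebraic_variety X" "nonsingular_of_dim X (points X) dimX"
    and Y: "real_subvariety X Y" "nonsingular_of_dim X Y dimY"
    and p: "p \<in> Y" "p \<in> real_points X (points X)"
    and tr: "transverse X Y (real_points X (points X))"
  shows "dimY = dimX"
proof -
  have alg: "algebraic_variety X" using X(1) by (simp add: real_algebraic_variety_def)
  have Y': "subvariety X Y" "invol X ` Y \<subseteq> Y" using Y(1) by (simp_all add: real_subvariety_def)
  obtain U \<phi> S G L P R where U: "(U, \<phi>) \<in> atlas X" "p \<in> U"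
    and c: "nonsingular_real_structure_chart X U \<phi> p S G L P R dimX"
    using real_structure_chart_exists[OF X p(2)] by metis
  have pY: "p \<in> Y" "p \<in> Y \<inter> U" using p U by blast+
  interpret nonsingular_real_structure_chart X U \<phi> p S G L P R dimX by (rule c)
  obtain PY RY where "dim (zariski_tangent (\<phi> ` (Y \<inter> U)) (\<phi> p)) = 2 * dimY"
    using local_equation_subvariety[OF alg U Y'(1) Y(2) pY(2)] by metis
  moreover have "zariski_tangent (\<phi> ` (Y \<inter> U)) (\<phi> p) = T"
    using tangent_subset_of_transverse[OF subvariety_subset[OF Y'(1)] Y'(2) pY(1) tr]
      zariski_tangent_mono[of "\<phi> ` (Y \<inter> U)" "\<phi> ` U"] by blast
  ultimately show ?thesis using dim by simp
qed

theorem theorem1: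
  fixes X :: "('a, 'n::finite) real_variety" and Y :: "'a set" and dimX dimY :: nat
  assumes "real_algebraic_variety X"
    and "nonsingular_of_dim X (points X) dimX"
    and "real_subvariety X Y"
    and "nonsingular_of_dim X Y dimY"
  shows "smooth_submanifold X Y \<and>
    smooth_submanifold X (real_points X (points X)) \<and>
    real_points X Y = Y \<inter> real_points X (points X) \<and>
    (\<not> (real_points X Y \<inter> real_points X (points X) = {} \<or> dimY = dimX) \<longrightarrow>
      \<not> transverse X Y (real_points X (points X)))"
proof (intro conjI impI notI)
  have alg: "algebraic_variety X" using assms(1) by (simp add: real_algebraic_variety_def)
  have Y: "subvariety X Y" using assms(3) by (simp add: real_subvariety_def)
  show "smooth_submanifold X Y"
    by (rule smooth_submanifold_subvariety[OF alg assms(2) Y assms(4)])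
  show "smooth_submanifold X (real_points X (points X))"
    by (rule smooth_submanifold_real_points[OF assms(1,2)])
  show eq: "real_points X Y = Y \<inter> real_points X (points X)"
    using subvariety_subset[OF Y] by (auto simp: real_points_def)
  assume "\<not> (real_points X Y \<inter> real_points X (points X) = {} \<or> dimY = dimX)"
    and tr: "transverse X Y (real_points X (points X))"
  then obtain p where "p \<in> Y" "p \<in> real_points X (points X)" "dimY \<noteq> dimX" using eq by blast
  then show False using dim_eq_of_transverse[OF assms _ _ tr] by blast
qed

end
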